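(* Let $C=\mathfrak{c}(\mathbf{w}_1,\dots,\mathbf{w}_n)$ be a simplicial cone in $\mathbb{R}^n$ generated by linearly independent unit vectors $\mathbf{w}_1,\dots,\mathbf{w}_n\in\mathbb{R}^n$. Then there exist an integer $N\le(n-1)!$, full-dimensional cones $C_1,\dots,C_N\subseteq\mathbb{R}^n$ and signs $s_1,\dots,s_N\in\{\pm1\}$ such that $$[C]\equiv\sum_{m=1}^N s_m[C_m]\quad\text{modulo indicator functions of lower-dimensional cones},$$ each $C_m$ is of the form $\mathfrak{c}(\mathbf{v}_1,\dots,\mathbf{v}_n)$ with generators satisfying properties (a)–(e) listed in the context, the normalized solid angle measure $\tilde\Omega_n(C_m)$ of each $C_m$ can be computed via the power series $T_{\boldsymbol\alpha}$ of $C_m$ given in the context (i.e. $T_{\boldsymbol\alpha}$ converges absolutely to $\tilde\Omega_n(C_m)$), and $$\tilde\Omega_n(C)=\sum_{m=1}^N s_m\,\tilde\Omega_n(C_m).$$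
   Context: $\mathfrak{c}(\cdot)$ denotes the cone of nonnegative linear combinations of the given vectors, $\langle\cdot\rangle$ the linear span, $[C]$ the indicator function of $C$. The relation "$\equiv$ modulo indicator functions of lower-dimensional cones" means that the difference of the two sides is a finite linear combination of indicator functions of polyhedral cones in $\mathbb{R}^n$ of affine dimension less than $n$. Normalized solid angle measure: $\tilde\Omega_n(C)=\mathrm{vol}_{n-1}(C\cap S_{n-1})/\mathrm{vol}_{n-1}(S_{n-1})$, where $S_{n-1}$ is the unit sphere in $\mathbb{R}^n$ centered at the origin; equivalently $\pi^{-n/2}\int_Ce^{-\|\mathbf{x}\|^2}d\mathbf{x}$. Properties of the generators $\mathbf{v}_1,\dots,\mathbf{v}_n$, where $M_n$ is the associated matrix of $\mathfrak{c}(\mathbf{v}_1,\dots,\mathbf{v}_n)$, with $(i,j)$ entry $-|\mathbf{v}_i\cdot\mathbf{v}_j|$ for $i\ne j$ and diagonal entries $1$: (a) $\|\mathbf{v}_i\|=1$ for all $i$; (b) $\mathbf{v}_n=\mathbf{w}_n$; (c) $\langle\mathbf{v}_1,\dots,\mathbf{v}_{n-1}\rangle=\langle\mathbf{w}_1,\dots,\mathbf{w}_{n-1}\rangle$; (d) $\mathbf{v}_i\cdot\mathbf{v}_n=0$ for $i=1,\dots,n-2$; (e) there are signs $\epsilon_i\in\{\pm1\}$ with $\mathbf{x}^TM_n\mathbf{x}=\|\sum_i\epsilon_ix_i\mathbf{v}_i\|^2$ for every $\mathbf{x}\in\mathbb{R}^n$ (so $M_n$ is positive definite). Power series of a cone $\mathfrak{c}(\mathbf{v}_1,\dots,\mathbf{v}_n)$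 with unit generators: with $V$ the matrix whose columns are the $\mathbf{v}_i$ and $\alpha_{ij}=\mathbf{v}_i\cdot\mathbf{v}_j$, $$T_{\boldsymbol\alpha}=\frac{|\det V|}{(4\pi)^{n/2}}\sum_{\mathbf{a}\in\mathbb{N}^{\binom n2}}\left[\frac{(-2)^{\sum_{i<j}a_{ij}}}{\prod_{i<j}a_{ij}!}\prod_{i=1}^n\Gamma\!\left(\frac{1+\sum_{m\ne i}a_{im}}{2}\right)\right]\prod_{i<j}\alpha_{ij}^{a_{ij}},$$ where $\mathbf{a}=(a_{ij})_{1\le i<j\le n}$, $a_{ij}=a_{ji}$ for $i>j$, $\mathbb{N}$ includes $0$, $0^0=1$. Known theorem (Ribando): for linearly independent unit generators, $T_{\boldsymbol\alpha}$ converges absolutely to the normalized solid angle measure of the cone if and only if the associated matrix is positive definite. *)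

theory Defs
  imports "HOL-Analysis.Analysis" "HOL-Probability.Distributions"
begin

text \<open>
  The space \<open>\<real>\<^sup>n\<close> is \<open>real^'n\<close>, where the index type \<open>'n\<close> is finite and well-ordered; thus
  \<open>n = CARD('n)\<close>, and the indices \<open>1, \<dots>, n\<close> are the elements of \<open>'n\<close> in increasing order.
  A list of \<open>n\<close> vectors of \<open>\<real>\<^sup>n\<close> is a function \<open>'n \<Rightarrow> real^'n\<close>.
\<close>

definition last_index :: "'n::{finite,wellorder}"
  where "last_index = Max UNIV"

definition gen_cone :: "('n::finite \<Rightarrow> real^'n) \<Rightarrow> (real^'n) set"
  where "gen_cone v = {\<Sum>i\<in>UNIV. c i *\<^sub>R v i | c. \<forall>i. 0 \<le> c i}"

definition lin_indep_family :: "('n::finite \<Rightarrow> real^'n) \<Rightarrow> bool"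
  where "lin_indep_family v \<longleftrightarrow> inj v \<and> independent (range v)"

definition polyhedral_cone :: "'a::euclidean_space set \<Rightarrow> bool"
  where "polyhedral_cone K \<longleftrightarrow> K \<noteq> {} \<and> polyhedron K \<and> conic K"

definition equiv_mod_lower_dim :: "('a::euclidean_space \<Rightarrow> real) \<Rightarrow> ('a \<Rightarrow> real) \<Rightarrow> bool"
  where "equiv_mod_lower_dim f g \<longleftrightarrow>
    (\<exists>\<K> c. finite \<K> \<and> (\<forall>K\<in>\<K>. polyhedral_cone K \<and> aff_dim K < int DIM('a)) \<and>
      (\<forall>x. f x - g x = (\<Sum>K\<in>\<K>. c K * indicat_real K x)))"


subsection \<open>Solid angle measure\<close>

text \<open>
  The surface measure of a subset \<open>A\<close> of the unit sphere is \<open>n\<close> times the Lebesgue measure of the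
  union of the radii ending in \<open>A\<close>; this is the usual surface measure of the polar decomposition
  \<open>dx = r\<^bsup>n-1\<^esup> dr d\<sigma>\<close> of Lebesgue measure.
\<close>

definition sphere_vol :: "'a::euclidean_space set \<Rightarrow> real"
  where "sphere_vol A =
    real DIM('a) * measure lebesgue {t *\<^sub>R x | t x. 0 \<le> t \<and> t \<le> 1 \<and> x \<in> A}"

definition solid_angle :: "'a::euclidean_space set \<Rightarrow> real"
  where "solid_angle C = sphere_vol (C \<inter> sphere 0 1) / sphere_vol (sphere (0::'a) 1)"


lemma conic_Int_cball:
  fixes C :: "'a::euclidean_space set"
  assumes "conic C"
  shows "{t *\<^sub>R x | t x. 0 \<le> t \<and> t \<le> 1 \<and> x \<in> C \<inter> sphere 0 1} - {0} = C \<inter> cball 0 1 - {0}"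
proof (intro equalityI subsetI)
  fix y assume "y \<in> {t *\<^sub>R x | t x. 0 \<le> t \<and> t \<le> 1 \<and> x \<in> C \<inter> sphere 0 1} - {0}"
  then show "y \<in> C \<inter> cball 0 1 - {0}"
    using assms by (auto simp: conic_def abs_le_iff)
next
  fix y assume y: "y \<in> C \<inter> cball 0 1 - {0}"
  then have "y = norm y *\<^sub>R (inverse (norm y) *\<^sub>R y)" "inverse (norm y) *\<^sub>R y \<in> C \<inter> sphere 0 1"
    using assms by (auto simp: conic_def)
  then show "y \<in> {t *\<^sub>R x | t x. 0 \<le> t \<and> t \<le> 1 \<and> x \<in> C \<inter> sphere 0 1} - {0}"
    using y by (smt (verit) Diff_iff IntD2 mem_Collect_eq mem_cball_0 norm_ge_zero)
qed

lemma sphere_vol_conic: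
  fixes C :: "'a::euclidean_space set"
  assumes "conic C" "C \<in> sets borel"
  shows "sphere_vol (C \<inter> sphere 0 1) = real DIM('a) * measure lborel (C \<inter> cball 0 1)"
proof -
  let ?R = "{t *\<^sub>R x | t x. 0 \<le> t \<and> t \<le> 1 \<and> x \<in> C \<inter> sphere 0 1}"
  have 0: "{0::'a} \<in> null_sets lebesgue"
    by (simp add: negligible_iff_null_sets[symmetric])
  have m: "C \<inter> cball 0 1 \<in> sets lborel"
    using assms(2) by auto
  then have mC: "C \<inter> cball 0 1 \<in> sets lebesgue" by (rule sets_completionI_sets)
  have "?R - {0} \<in> sets lebesgue"
    unfolding conic_Int_cball[OF assms(1)] using mC by auto
  moreover have "?R \<inter> {0} \<in> sets lebesgue"
    using null_setsD2[OF 0] by (cases "0 \<in> ?R") auto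
  ultimately have "(?R - {0}) \<union> (?R \<inter> {0}) \<in> sets lebesgue"
    by (rule sets.Un)
  then have mR: "?R \<in> sets lebesgue"
    by (simp only: Un_Diff_Int)
  have "measure lebesgue ?R = measure lebesgue (?R - {0})"
    using measure_Diff_null_set[OF mR 0] by simp
  also have "\<dots> = measure lebesgue (C \<inter> cball 0 1)"
    unfolding conic_Int_cball[OF assms(1)] using measure_Diff_null_set[OF mC 0] by simp
  also have "\<dots> = measure lborel (C \<inter> cball 0 1)"
    using m by (simp add: measure_completion)
  finally show ?thesis unfolding sphere_vol_def by simp
qed

lemma nn_integral_gaussian_conic:
  fixes C :: "'a::euclidean_space set"
  assumes "conic C" and [measurable]: "C \<in> sets borel"
  shows "(\<integral>\<^sup>+x. ennreal (exp (- (norm x)\<^sup>2)) * indicator C x \<partial>lborel) =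
    (\<integral>\<^sup>+t. ennreal (2 * t * exp (- t\<^sup>2) * t ^ DIM('a)) * indicator {0..} t \<partial>lborel) *
    emeasure lborel (C \<inter> cball 0 1)"
proof -
  let ?g = "\<lambda>t::real. ennreal (2 * t * exp (- t\<^sup>2))"
  have layer: "ennreal (exp (- b\<^sup>2)) = (\<integral>\<^sup>+t. ?g t * indicator {b..} t \<partial>lborel)" if "0 \<le> b" for b :: real
  proof -
    have lim: "((\<lambda>t::real. - exp (- t\<^sup>2)) \<longlongrightarrow> 0) at_top"
      by real_asymp
    have "(\<integral>\<^sup>+t. ?g t * indicator {b..} t \<partial>lborel) = ennreal (0 - (- exp (- b\<^sup>2)))"
      by (rule nn_integral_FTC_atLeast[OF _ _ _ lim])
        (use that in \<open>auto intro!: derivative_eq_intros\<close>)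
    then show ?thesis by simp
  qed
  have scale: "emeasure lborel (C \<inter> cball 0 t) = ennreal (t ^ DIM('a)) * emeasure lborel (C \<inter> cball 0 1)"
    if "0 < t" for t :: real
  proof -
    have "C \<inter> cball 0 t = (\<lambda>x. t *\<^sub>R x + 0) ` (C \<inter> cball 0 1)"
    proof (intro equalityI subsetI)
      fix x assume x: "x \<in> C \<inter> cball 0 t"
      then have "x = t *\<^sub>R (inverse t *\<^sub>R x) + 0" "inverse t *\<^sub>R x \<in> C \<inter> cball 0 1"
        using assms that by (auto simp: conic_def field_simps)
      then show "x \<in> (\<lambda>x. t *\<^sub>R x + 0) ` (C \<inter> cball 0 1)" by blast
    next
      fix x assume "x \<in> (\<lambda>x. t *\<^sub>R x + 0) ` (C \<inter> cball 0 1)"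
      then show "x \<in> C \<inter> cball 0 t"
        using assms that by (auto simp: conic_def)
    qed
    then have "emeasure lebesgue (C \<inter> cball 0 t) = \<bar>t\<bar> ^ DIM('a) * emeasure lebesgue (C \<inter> cball 0 1)"
      using emeasure_lebesgue_affine[of t 0 "C \<inter> cball 0 1"] by simp
    then show ?thesis using that by (simp add: emeasure_completion)
  qed
  have "(\<integral>\<^sup>+x. ennreal (exp (- (norm x)\<^sup>2)) * indicator C x \<partial>lborel) =
      (\<integral>\<^sup>+x. (\<integral>\<^sup>+t. ?g t * indicator {norm x..} t \<partial>lborel) * indicator C x \<partial>lborel)"
    by (simp add: layer)
  also have "\<dots> = (\<integral>\<^sup>+x. (\<integral>\<^sup>+t. ?g t * (if norm x \<le> t then 1 else 0) * indicator C x \<partial>lborel) \<partial>lborel)"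
    by (subst nn_integral_multc[symmetric]) (auto intro!: nn_integral_cong simp: indicator_def)
  also have "\<dots> = (\<integral>\<^sup>+t. (\<integral>\<^sup>+x. ?g t * (if norm x \<le> t then 1 else 0) * indicator C (x::'a) \<partial>lborel) \<partial>lborel)"
    by (rule lborel_pair.Fubini') measurable
  also have "\<dots> = (\<integral>\<^sup>+t. ?g t * emeasure lborel (C \<inter> cball 0 t) \<partial>lborel)"
  proof (rule nn_integral_cong)
    fix t :: real
    have "(\<integral>\<^sup>+x. ?g t * (if norm x \<le> t then 1 else 0) * indicator C (x::'a) \<partial>lborel) =
        (\<integral>\<^sup>+x. ?g t * indicator (C \<inter> cball 0 t) x \<partial>lborel)"
      by (rule nn_integral_cong) (auto simp: indicator_def)
    also have "\<dots> = ?g t * emeasure lborel (C \<inter> cball 0 t)"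
      by (rule nn_integral_cmult_indicator) auto
    finally show "(\<integral>\<^sup>+x. ?g t * (if norm x \<le> t then 1 else 0) * indicator C (x::'a) \<partial>lborel) = \<dots>" .
  qed
  also have "\<dots> = (\<integral>\<^sup>+t. ennreal (2 * t * exp (- t\<^sup>2) * t ^ DIM('a)) * indicator {0..} t *
      emeasure lborel (C \<inter> cball 0 1) \<partial>lborel)"
  proof (rule nn_integral_cong)
    fix t :: real
    show "?g t * emeasure lborel (C \<inter> cball 0 t) =
      ennreal (2 * t * exp (- t\<^sup>2) * t ^ DIM('a)) * indicator {0..} t * emeasure lborel (C \<inter> cball 0 1)"
    proof (cases "0 < t")
      case True
      have "?g t * ennreal (t ^ DIM('a)) = ennreal (2 * t * exp (- t\<^sup>2) * t ^ DIM('a))"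
        using True by (intro ennreal_mult[symmetric]) auto
      then show ?thesis
        using True by (simp only: scale[OF True] mult.assoc[symmetric]) simp
    next
      case False
      then show ?thesis
        by (cases "t = 0") (auto simp: ennreal_neg mult_le_0_iff)
    qed
  qed
  also have "\<dots> = (\<integral>\<^sup>+t. ennreal (2 * t * exp (- t\<^sup>2) * t ^ DIM('a)) * indicator {0..} t \<partial>lborel) *
      emeasure lborel (C \<inter> cball 0 1)"
    by (rule nn_integral_multc) auto
  finally show ?thesis .
qed

lemma nn_integral_gaussian_UNIV:
  "(\<integral>\<^sup>+x. ennreal (exp (- (norm (x::'a::euclidean_space))\<^sup>2)) \<partial>lborel) =
    ennreal (pi powr (real DIM('a) / 2))"
proof -
  have hb: "has_bochner_integral lborel (\<lambda>x::real. exp (- x\<^sup>2)) (sqrt pi)"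
    using has_bochner_integral_even_function[OF gaussian_moment_0] by simp
  have one: "(\<integral>\<^sup>+x. ennreal (exp (- (x::real)\<^sup>2)) \<partial>lborel) = ennreal (sqrt pi)"
    using hb by (subst nn_integral_eq_integral) (auto simp: has_bochner_integral_iff)
  have "(\<integral>\<^sup>+x. ennreal (exp (- (norm (x::'a))\<^sup>2)) \<partial>lborel) =
      (\<integral>\<^sup>+x. (\<Prod>b\<in>Basis. ennreal (exp (- ((x::'a) \<bullet> b)\<^sup>2))) \<partial>lborel)"
  proof (rule nn_integral_cong)
    fix x :: 'a
    have "- (norm x)\<^sup>2 = (\<Sum>b\<in>Basis. - (x \<bullet> b)\<^sup>2)"
      unfolding power2_norm_eq_inner euclidean_inner[of x x] sum_negf by (simp add: power2_eq_square)
    then have "exp (- (norm x)\<^sup>2) = (\<Prod>b\<in>Basis. exp (- (x \<bullet> b)\<^sup>2))"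
      by (simp only: exp_sum[OF finite_Basis])
    then show "ennreal (exp (- (norm x)\<^sup>2)) = (\<Prod>b\<in>Basis. ennreal (exp (- (x \<bullet> b)\<^sup>2)))"
      by (simp add: prod_ennreal)
  qed
  also have "\<dots> = ennreal (sqrt pi) ^ DIM('a)"
    by (subst nn_integral_lborel_prod) (simp_all add: one)
  also have "\<dots> = ennreal (pi powr (real DIM('a) / 2))"
    by (simp add: ennreal_power powr_half_sqrt[symmetric] powr_realpow[symmetric] powr_powr)
  finally show ?thesis .
qed

text \<open>The surface measure agrees with the Gaussian form of the solid angle measure.\<close>

lemma solid_angle_eq_gaussian_integral:
  fixes C :: "'a::euclidean_space set"
  assumes "conic C" and [measurable]: "C \<in> sets borel"
  shows "solid_angle C = pi powr (- (real DIM('a) / 2)) * (LINT x:C|lborel. exp (- (norm x)\<^sup>2))"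
proof -
  define K where "K = (\<integral>\<^sup>+t. ennreal (2 * t * exp (- t\<^sup>2) * t ^ DIM('a)) * indicator {0..} t \<partial>lborel)"
  have fin: "emeasure lborel (C \<inter> cball 0 1) < \<infinity>"
    by (rule le_less_trans[OF emeasure_mono[of _ "cball 0 1"] emeasure_lborel_cball_finite]) auto
  have C: "(\<integral>\<^sup>+x. ennreal (exp (- (norm x)\<^sup>2)) * indicator C x \<partial>lborel) = K * emeasure lborel (C \<inter> cball 0 1)"
    unfolding K_def by (rule nn_integral_gaussian_conic) (use assms in auto)
  have U: "ennreal (pi powr (real DIM('a) / 2)) = K * emeasure lborel (cball (0::'a) 1)"
    using nn_integral_gaussian_conic[of "UNIV::'a set"] nn_integral_gaussian_UNIV[where 'a='a]
    unfolding K_def by (simp add: conic_def)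
  define B where "B = measure lborel (cball (0::'a) 1)"
  have B: "B > 0" unfolding B_def
    using content_cball_pos[of 1 "0::'a"] by simp
  have eB: "emeasure lborel (cball (0::'a) 1) = ennreal B"
    unfolding B_def using emeasure_eq_ennreal_measure emeasure_lborel_cball_finite
    by (metis infinity_ennreal_def less_irrefl)
  have "K \<noteq> top"
    using U eB B by (auto simp: ennreal_top_mult)
  then obtain k where k: "K = ennreal k" "0 \<le> k" by (cases K) auto
  have kB: "pi powr (real DIM('a) / 2) = k * B"
    using U eB B k by (simp add: ennreal_mult[symmetric])
  have "(LINT x:C|lborel. exp (- (norm x)\<^sup>2)) =
      enn2real (\<integral>\<^sup>+x. ennreal (indicat_real C x * exp (- (norm x)\<^sup>2)) \<partial>lborel)"
    unfolding set_lebesgue_integral_def by (subst integral_eq_nn_integral) auto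
  also have "(\<integral>\<^sup>+x. ennreal (indicat_real C x * exp (- (norm x)\<^sup>2)) \<partial>lborel) =
      K * emeasure lborel (C \<inter> cball 0 1)"
    unfolding C[symmetric] by (rule nn_integral_cong) (auto simp: indicator_def)
  also have "enn2real \<dots> = k * measure lborel (C \<inter> cball 0 1)"
    by (simp add: enn2real_mult k measure_def)
  finally have I: "(LINT x:C|lborel. exp (- (norm x)\<^sup>2)) = k * measure lborel (C \<inter> cball 0 1)" .
  have "solid_angle C = measure lborel (C \<inter> cball 0 1) / B"
    unfolding solid_angle_def sphere_vol_conic[OF assms] B_def
    using sphere_vol_conic[of "UNIV::'a set"] by (simp add: conic_def)
  also have "\<dots> = pi powr (- (real DIM('a) / 2)) * (k * measure lborel (C \<inter> cball 0 1))"
  proof -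
    have "k \<noteq> 0" using kB by auto
    then show ?thesis using B by (simp add: powr_minus kB field_simps)
  qed
  finally show ?thesis by (simp add: I)
qed


subsection \<open>Associated matrix and the properties of the generators\<close>

definition assoc_matrix :: "('n::finite \<Rightarrow> real^'n) \<Rightarrow> real^'n^'n"
  where "assoc_matrix v = (\<chi> i j. if i = j then 1 else - \<bar>v i \<bullet> v j\<bar>)"

definition pos_definite :: "real^'n^'n::finite \<Rightarrow> bool"
  where "pos_definite M \<longleftrightarrow> transpose M = M \<and> (\<forall>x. x \<noteq> 0 \<longrightarrow> 0 < x \<bullet> (M *v x))"

text \<open>In the fourth condition, the \<open>i\<close> with \<open>i < j < last_index\<close> for some \<open>j\<close> are the indices
  \<open>1, \<dots>, n - 2\<close>.\<close>

definition good_generators ::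
    "('n \<Rightarrow> real^'n::{finite,wellorder}) \<Rightarrow> ('n \<Rightarrow> real^'n::{finite,wellorder}) \<Rightarrow> bool"
  where "good_generators w v \<longleftrightarrow>
    (\<forall>i. norm (v i) = 1) \<and>
    v last_index = w last_index \<and>
    span (v ` {..<last_index}) = span (w ` {..<last_index}) \<and>
    (\<forall>i j. i < j \<and> j < last_index \<longrightarrow> v i \<bullet> v last_index = 0) \<and>
    (\<exists>\<epsilon>. (\<forall>i. \<epsilon> i \<in> {-1, 1}) \<and>
      (\<forall>x. x \<bullet> (assoc_matrix v *v x) = (norm (\<Sum>i\<in>UNIV. (\<epsilon> i * x $ i) *\<^sub>R v i))\<^sup>2)) \<and>
    pos_definite (assoc_matrix v)"


subsection \<open>The power series\<close>

definition index_pairs :: "('n::{finite,wellorder} \<times> 'n) set"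
  where "index_pairs = {(i, j). i < j}"

definition multi_indices :: "('n::{finite,wellorder} \<times> 'n \<Rightarrow> nat) set"
  where "multi_indices = index_pairs \<rightarrow>\<^sub>E UNIV"

text \<open>\<open>a\<^sub>i\<^sub>m\<close> for \<open>i \<noteq> m\<close>, with the convention \<open>a\<^sub>i\<^sub>m = a\<^sub>m\<^sub>i\<close>.\<close>

definition sym_entry :: "('n::{finite,wellorder} \<times> 'n \<Rightarrow> nat) \<Rightarrow> 'n \<Rightarrow> 'n \<Rightarrow> nat"
  where "sym_entry a i m = a (min i m, max i m)"

definition series_term ::
    "('n \<Rightarrow> real^'n::{finite,wellorder}) \<Rightarrow> ('n \<times> 'n \<Rightarrow> nat) \<Rightarrow> real"
  where "series_term v a =
    (-2) ^ (\<Sum>p\<in>index_pairs. a p) / (\<Prod>p\<in>index_pairs. fact (a p))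
    * (\<Prod>i\<in>UNIV. Gamma ((1 + real (\<Sum>m\<in>UNIV - {i}. sym_entry a i m)) / 2))
    * (\<Prod>(i, j)\<in>index_pairs. (v i \<bullet> v j) ^ a (i, j))"

definition series_factor :: "('n \<Rightarrow> real^'n::{finite,wellorder}) \<Rightarrow> real"
  where "series_factor v =
    \<bar>det (\<chi> i j. v j $ i)\<bar> / (4 * pi) powr (real CARD('n) / 2)"

definition series_converges_to :: "('n \<Rightarrow> real^'n::{finite,wellorder}) \<Rightarrow> real \<Rightarrow> bool"
  where "series_converges_to v s \<longleftrightarrow>
    (\<lambda>a. \<bar>series_term v a\<bar>) summable_on multi_indices \<and>
    series_factor v * (\<Sum>\<^sub>\<infinity>a\<in>multi_indices. series_term v a) = s"

end

theory Submission
  imports Defs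
begin

text \<open>
  Write \<open>w\<^sub>n\<close> for the last generator and let \<open>f(w\<^sub>j) = w\<^sub>j \<bullet> w\<^sub>n\<close> for \<open>j < n\<close>. As in the Lawrence-Varchenko
  formula for simplices, the cone is a signed sum, over the \<open>i < n\<close> with \<open>f(w\<^sub>i) \<noteq> 0\<close>, of cones in which
  every other \<open>w\<^sub>j\<close> is replaced by \<open>\<plusminus>(w\<^sub>j - (f(w\<^sub>j) / f(w\<^sub>i)) w\<^sub>i)\<close>, which is orthogonal to \<open>w\<^sub>n\<close>. With \<open>w\<^sub>i\<close>
  moved to position \<open>n - 1\<close>, only the neighbours \<open>n - 1\<close> and \<open>n\<close> can still have a nonzero inner product
  involving \<open>n\<close>. Repeating this with \<open>n - 1\<close>, \<open>n - 2\<close>, \<open>\<dots>\<close> in place of \<open>n\<close> produces at most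
  \<open>(n - 1)!\<close> cones whose generators have a tridiagonal Gram matrix. The off-diagonal signs of such a matrix
  can be made nonpositive by changing signs of generators, so the associated matrix is positive definite.

  The power series arises from the Gaussian form of the solid angle: in the coordinates of the generators
  one expands \<open>exp (- 2 \<Sum>\<^sub>i\<^sub><\<^sub>j \<alpha>\<^sub>i\<^sub>j y\<^sub>i y\<^sub>j)\<close> and integrates termwise over the orthant. The absolute values of the
  terms sum to \<open>exp (- y \<bullet> M y)\<close>, where \<open>M\<close> is the associated matrix, so that positive definiteness justifies
  the exchange of sum and integral.
\<close>

section \<open>Simplicial cones and dual bases\<close>

text \<open>A dual basis certifies linear independence, and \<open>d i \<bullet> x\<close> is the
  \<open>i\<close>-th coordinate of \<open>x\<close>, so that membership in the cone becomes a
  family of sign conditions.\<close>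

definition biorthogonal :: "('n::finite \<Rightarrow> real^'n) \<Rightarrow> ('n \<Rightarrow> real^'n) \<Rightarrow> bool"
  where "biorthogonal d v \<longleftrightarrow> (\<forall>i j. d i \<bullet> v j = (if i = j then 1 else 0))"

lemma biorthogonal_inner_sum:
  assumes "biorthogonal d v"
  shows "d i \<bullet> (\<Sum>j\<in>UNIV. c j *\<^sub>R v j) = c i"
proof -
  have "d i \<bullet> (\<Sum>j\<in>UNIV. c j *\<^sub>R v j) = (\<Sum>j\<in>UNIV. if i = j then c j else 0)"
    unfolding inner_sum_right using assms by (intro sum.cong) (auto simp: biorthogonal_def)
  then show ?thesis by simp
qed

text \<open>Biorthogonality makes \<open>D\<close> a left inverse of the square matrix
  \<open>V\<close> with columns \<open>v i\<close>. It is then a right inverse as well, and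
  \<open>V ** D = mat 1\<close> applied to \<open>x\<close> is the expansion.\<close>

lemma biorthogonal_expansion:
  fixes d v :: "'n::finite \<Rightarrow> real^'n"
  assumes "biorthogonal d v"
  shows "x = (\<Sum>i\<in>UNIV. (d i \<bullet> x) *\<^sub>R v i)"
proof -
  define D V where "D = (\<chi> i. d i)" and "V = transpose (\<chi> i. v i)"
  have "D ** V = mat 1"
    using assms by (simp add: vec_eq_iff matrix_matrix_mult_def D_def V_def transpose_def
        mat_def biorthogonal_def inner_vec_def)
  then have "V ** D = mat 1"
    by (simp add: matrix_left_right_inverse)
  then have "x = V *v (D *v x)"
    by (simp add: matrix_vector_mul_assoc)
  also have "\<dots> = (\<Sum>i\<in>UNIV. (D *v x) $ i *s column i V)"
    by (rule matrix_mult_sum)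
  also have "\<dots> = (\<Sum>i\<in>UNIV. (d i \<bullet> x) *\<^sub>R v i)"
    by (simp add: scalar_mult_eq_scaleR D_def V_def matrix_vector_mul_component row_def)
  finally show ?thesis .
qed

lemma span_range_biorthogonal:
  assumes "biorthogonal d v"
  shows "span (range v) = UNIV"
proof -
  have "x \<in> span (range v)" for x
    by (subst biorthogonal_expansion[OF assms, of x]) (intro span_sum span_scale span_base rangeI)
  then show ?thesis by auto
qed

lemma biorthogonal_exists:
  fixes w :: "'n::finite \<Rightarrow> real^'n"
  assumes "lin_indep_family w"
  obtains d where "biorthogonal d w"
proof -
  define V where "V = transpose (\<chi> i. w i)"
  have "c i = 0" if "(\<Sum>i\<in>UNIV. c i *s column i V) = 0" for c i
  proof -
    \<comment> \<open>Independence concerns the set \<open>range w\<close>; \<open>inv w\<close>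
      carries coefficients from indices to vectors.\<close>
    have "(\<Sum>v\<in>range w. c (inv w v) *\<^sub>R v) = 0"
      using that assms
      by (simp add: sum.reindex lin_indep_family_def V_def scalar_mult_eq_scaleR row_def)
    then have "\<forall>v\<in>range w. c (inv w v) = 0"
      using assms unfolding lin_indep_family_def by (auto simp: independent_explicit)
    then show ?thesis
      using assms by (auto simp: lin_indep_family_def)
  qed
  then obtain B where B: "B ** V = mat 1"
    using matrix_left_invertible_independent_columns by blast
  have "biorthogonal (\<lambda>i. B $ i) w"
    using B by (simp add: vec_eq_iff matrix_matrix_mult_def V_def transpose_def
        mat_def biorthogonal_def inner_vec_def)
  then show ?thesis by (rule that)
qed

lemma biorthogonal_scale:
  assumes "biorthogonal d v" "\<And>i. t i \<noteq> 0"
  shows "biorthogonal (\<lambda>i. inverse (t i) *\<^sub>R d i) (\<lambda>i. t i *\<^sub>R v i)"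
  using assms by (auto simp: biorthogonal_def)

lemma biorthogonal_compose:
  assumes "biorthogonal d v" "inj p"
  shows "biorthogonal (d \<circ> p) (v \<circ> p)"
  using assms by (auto simp: biorthogonal_def inj_def)

lemma gen_cone_biorthogonal:
  assumes "biorthogonal d v"
  shows "gen_cone v = {x. \<forall>i. 0 \<le> d i \<bullet> x}"
proof (intro equalityI subsetI)
  fix x assume "x \<in> gen_cone v"
  then show "x \<in> {x. \<forall>i. 0 \<le> d i \<bullet> x}"
    by (auto simp: gen_cone_def biorthogonal_inner_sum[OF assms])
next
  fix x assume "x \<in> {x. \<forall>i. 0 \<le> d i \<bullet> x}"
  then show "x \<in> gen_cone v"
    using biorthogonal_expansion[OF assms, of x] by (auto simp: gen_cone_def)
qed

lemma polyhedral_cone_gen_cone: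
  assumes "biorthogonal d v"
  shows "polyhedral_cone (gen_cone v)"
proof -
  have eq: "gen_cone v = (\<Inter>i. {x. d i \<bullet> x \<ge> 0})"
    unfolding gen_cone_biorthogonal[OF assms] by auto
  have "polyhedron (gen_cone v)"
    unfolding eq by (rule polyhedron_Inter) (auto simp: polyhedron_halfspace_ge)
  moreover have "0 \<in> gen_cone v"
    unfolding gen_cone_biorthogonal[OF assms] by simp
  moreover have "conic (gen_cone v)"
    unfolding gen_cone_biorthogonal[OF assms] by (simp add: conic_def)
  ultimately show ?thesis
    unfolding polyhedral_cone_def by blast
qed

lemma aff_dim_gen_cone:
  fixes v :: "'n::finite \<Rightarrow> real^'n"
  assumes "biorthogonal d v"
  shows "aff_dim (gen_cone v) = int CARD('n)"
proof -
  have "range v \<subseteq> gen_cone v"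
    using assms by (auto simp: gen_cone_biorthogonal[OF assms] biorthogonal_def)
  then have "span (gen_cone v) = UNIV"
    using span_range_biorthogonal[OF assms] span_mono by blast
  moreover have "0 \<in> gen_cone v"
    unfolding gen_cone_biorthogonal[OF assms] by simp
  ultimately show ?thesis
    using aff_dim_zero[OF hull_inc] dim_span[of "gen_cone v"] by simp
qed

section \<open>Indicator functions modulo lower-dimensional cones\<close>

text \<open>The predicate is a parameter because a difference of indicators is first a combination
  of arbitrary polyhedral cones and only afterwards, through the location of its support, one of
  lower-dimensional cones.\<close>

definition cone_comb :: "('a::euclidean_space set \<Rightarrow> bool) \<Rightarrow> ('a \<Rightarrow> real) \<Rightarrow> bool"
  where "cone_comb P f \<longleftrightarrow> (\<exists>\<K> c. finite \<K> \<and> (\<forall>K\<in>\<K>. P K) \<and>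
    (\<forall>x. f x = (\<Sum>K\<in>\<K>. c K * indicat_real K x)))"

abbreviation lower_dim_cone :: "'a::euclidean_space set \<Rightarrow> bool"
  where "lower_dim_cone K \<equiv> polyhedral_cone K \<and> aff_dim K < int DIM('a)"

lemma equiv_mod_lower_dim_iff:
  "equiv_mod_lower_dim f g \<longleftrightarrow> cone_comb lower_dim_cone (\<lambda>x. f x - g x)"
  unfolding equiv_mod_lower_dim_def cone_comb_def ..

lemma cone_comb_zero: "cone_comb P (\<lambda>x. 0)"
  unfolding cone_comb_def by (rule exI[of _ "{}"]) simp

lemma cone_comb_indicator: "P K \<Longrightarrow> cone_comb P (indicat_real K)"
  unfolding cone_comb_def by (rule exI[of _ "{K}"], rule exI[of _ "\<lambda>_. 1"]) simp

lemma cone_comb_cmult: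
  assumes "cone_comb P f" shows "cone_comb P (\<lambda>x. a * f x)"
proof -
  obtain \<K> c where "finite \<K>" "\<forall>K\<in>\<K>. P K" "\<And>x. f x = (\<Sum>K\<in>\<K>. c K * indicat_real K x)"
    using assms unfolding cone_comb_def by blast
  then show ?thesis unfolding cone_comb_def
    by (intro exI[of _ \<K>] exI[of _ "\<lambda>K. a * c K"]) (simp only: sum_distrib_left mult.assoc, simp)
qed

lemma cone_comb_add:
  assumes "cone_comb P f" "cone_comb P g" shows "cone_comb P (\<lambda>x. f x + g x)"
proof -
  obtain \<K> c where K: "finite \<K>" "\<forall>K\<in>\<K>. P K" "\<And>x. f x = (\<Sum>K\<in>\<K>. c K * indicat_real K x)"
    using assms unfolding cone_comb_def by blast
  obtain \<L> b where L: "finite \<L>" "\<forall>K\<in>\<L>. P K" "\<And>x. g x = (\<Sum>K\<in>\<L>. b K * indicat_real K x)"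
    using assms unfolding cone_comb_def by blast
  \<comment> \<open>The two families may share cones, whose coefficients then add up.\<close>
  define e where "e K = (if K \<in> \<K> then c K else 0) + (if K \<in> \<L> then b K else 0)" for K
  have "f x + g x = (\<Sum>K\<in>\<K> \<union> \<L>. e K * indicat_real K x)" for x
  proof -
    have "f x = (\<Sum>K\<in>\<K> \<union> \<L>. (if K \<in> \<K> then c K else 0) * indicat_real K x)"
      unfolding K(3) by (rule sum.mono_neutral_cong_left) (use K L in auto)
    moreover have "g x = (\<Sum>K\<in>\<K> \<union> \<L>. (if K \<in> \<L> then b K else 0) * indicat_real K x)"
      unfolding L(3) by (rule sum.mono_neutral_cong_left) (use K L in auto)
    ultimately show ?thesis
      by (simp add: e_def distrib_right sum.distrib)
  qed
  then show ?thesis unfolding cone_comb_def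
    using K L by (intro exI[of _ "\<K> \<union> \<L>"] exI[of _ e]) auto
qed

lemma cone_comb_diff:
  assumes "cone_comb P f" "cone_comb P g" shows "cone_comb P (\<lambda>x. f x - g x)"
  using cone_comb_add[OF assms(1) cone_comb_cmult[OF assms(2), of "-1"]] by simp

lemma cone_comb_sum:
  "(\<And>i. i \<in> I \<Longrightarrow> cone_comb P (f i)) \<Longrightarrow> cone_comb P (\<lambda>x. \<Sum>i\<in>I. f i x)"
  by (induction I rule: infinite_finite_induct) (simp_all add: cone_comb_zero cone_comb_add)

lemma polyhedral_cone_Int_hyperplane:
  assumes "polyhedral_cone K"
  shows "polyhedral_cone (K \<inter> {x. a \<bullet> x = 0})"
proof -
  \<comment> \<open>Scaling by \<open>0\<close> puts the origin into every nonempty conic set; this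
    keeps the intersection nonempty.\<close>
  have "0 \<in> K"
    using assms unfolding polyhedral_cone_def conic_def by force
  then show ?thesis
    using assms by (auto simp: polyhedral_cone_def conic_def polyhedron_hyperplane)
qed

lemma lower_dim_cone_Int_hyperplane:
  assumes "polyhedral_cone K" "a \<noteq> 0"
  shows "lower_dim_cone (K \<inter> {x. a \<bullet> x = 0})"
proof -
  have "aff_dim (K \<inter> {x. a \<bullet> x = 0}) \<le> aff_dim {x. a \<bullet> x = 0}"
    by (intro aff_dim_subset) auto
  then show ?thesis
    using polyhedral_cone_Int_hyperplane[OF assms(1)] assms(2) by (simp add: aff_dim_hyperplane)
qed

lemma cone_comb_restrict:
  assumes "cone_comb P f" "\<And>K. P K \<Longrightarrow> Q (K \<inter> H)"
  shows "cone_comb Q (\<lambda>x. f x * indicat_real H x)"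
proof -
  obtain \<K> c where K: "\<forall>K\<in>\<K>. P K" "\<And>x. f x = (\<Sum>K\<in>\<K>. c K * indicat_real K x)"
    using assms unfolding cone_comb_def by blast
  have "(\<lambda>x. f x * indicat_real H x) = (\<lambda>x. \<Sum>K\<in>\<K>. c K * indicat_real (K \<inter> H) x)"
    unfolding K(2) sum_distrib_right by (intro ext sum.cong) (auto simp: indicator_def)
  then show ?thesis
    using K(1) assms(2) by (auto intro!: cone_comb_sum cone_comb_cmult cone_comb_indicator)
qed

text \<open>Split \<open>f = f [H] + f (1 - [H])\<close> for one hyperplane \<open>H\<close> at a time.\<close>

lemma cone_comb_lower_dim:
  assumes "finite A" "0 \<notin> A" "cone_comb polyhedral_cone f"
    and "\<And>x. f x \<noteq> 0 \<Longrightarrow> \<exists>a\<in>A. a \<bullet> x = 0"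
  shows "cone_comb lower_dim_cone f"
  using assms
proof (induction A arbitrary: f rule: finite_induct)
  case empty
  then have "f = (\<lambda>x. 0)" by auto
  then show ?case by (simp add: cone_comb_zero)
next
  case (insert a A)
  let ?H = "{x. a \<bullet> x = 0}"
  have "cone_comb polyhedral_cone (\<lambda>x. f x * indicat_real ?H x)"
    by (rule cone_comb_restrict[where P = polyhedral_cone])
      (fact insert.prems(2), fact polyhedral_cone_Int_hyperplane)
  \<comment> \<open>The part off \<open>?H\<close> is supported on the hyperplanes given by
    \<open>A\<close>, so the induction hypothesis covers it. The part on \<open>?H\<close> combines
    cones \<open>K \<inter> ?H\<close>, which lie in a hyperplane.\<close>
  then have "cone_comb polyhedral_cone (\<lambda>x. f x - f x * indicat_real ?H x)"
    using insert.prems by (intro cone_comb_diff)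
  then have "cone_comb lower_dim_cone (\<lambda>x. f x - f x * indicat_real ?H x)"
    by (rule insert.IH[rotated]) (use insert.prems in \<open>fastforce simp: indicator_def split: if_splits\<close>)+
  moreover have "cone_comb lower_dim_cone (\<lambda>x. f x * indicat_real ?H x)"
    using insert.prems(1) by (intro cone_comb_restrict[OF insert.prems(2)] lower_dim_cone_Int_hyperplane) auto
  ultimately have "cone_comb lower_dim_cone (\<lambda>x. (f x - f x * indicat_real ?H x) + f x * indicat_real ?H x)"
    by (rule cone_comb_add)
  then show ?case by simp
qed

text \<open>Replace the factors \<open>p\<close> by \<open>q\<close> one at a time, from the
  smallest index upwards; each summand is the change at one replacement. In the induction a new
  maximum \<open>m\<close> multiplies all earlier summands by \<open>p m\<close>.\<close>

lemma prod_diff_telescope: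
  fixes p q :: "'i::linorder \<Rightarrow> 'a::comm_ring_1"
  assumes "finite Q"
  shows "(\<Sum>i\<in>Q. (\<Prod>j\<in>{j\<in>Q. j < i}. q j) * (p i - q i) * (\<Prod>j\<in>{j\<in>Q. i < j}. p j)) =
    (\<Prod>j\<in>Q. p j) - (\<Prod>j\<in>Q. q j)"
  using assms
proof (induction Q rule: finite_linorder_max_induct)
  case empty
  then show ?case by simp
next
  case (insert m Q)
  have m: "m \<notin> Q" using insert by auto
  have 1: "{j\<in>insert m Q. j < i} = {j\<in>Q. j < i}" "{j\<in>insert m Q. i < j} = insert m {j\<in>Q. i < j}"
    if "i \<in> Q" for i using insert that by auto
  have 2: "{j\<in>insert m Q. j < m} = Q" "{j\<in>insert m Q. m < j} = {}"
    using insert by auto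
  have "(\<Sum>i\<in>insert m Q. (\<Prod>j\<in>{j\<in>insert m Q. j < i}. q j) * (p i - q i) * (\<Prod>j\<in>{j\<in>insert m Q. i < j}. p j)) =
    (\<Prod>j\<in>Q. q j) * (p m - q m) +
    (\<Sum>i\<in>Q. (\<Prod>j\<in>{j\<in>insert m Q. j < i}. q j) * (p i - q i) * (\<Prod>j\<in>{j\<in>insert m Q. i < j}. p j))"
    using insert.hyps m by (subst sum.insert) (simp_all only: 2 prod.empty mult_1_right simp_thms)
  also have "(\<Sum>i\<in>Q. (\<Prod>j\<in>{j\<in>insert m Q. j < i}. q j) * (p i - q i) * (\<Prod>j\<in>{j\<in>insert m Q. i < j}. p j)) =
    (\<Sum>i\<in>Q. (\<Prod>j\<in>{j\<in>Q. j < i}. q j) * (p i - q i) * (\<Prod>j\<in>{j\<in>Q. i < j}. p j)) * p m"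
    unfolding sum_distrib_right using m insert.hyps
    by (intro sum.cong refl) (simp only: 1, subst prod.insert, auto simp: mult_ac)
  finally show ?case
    unfolding insert.IH by (simp only: prod.insert[OF insert.hyps(1) m]) (simp add: algebra_simps)
qed

section \<open>One step of the decomposition\<close>

lemma prod_of_bool:
  "finite A \<Longrightarrow> (\<Prod>j\<in>A. of_bool (P j)) = (of_bool (\<forall>j\<in>A. P j) :: 'a::comm_semiring_1)"
  by (induction A rule: finite_induct) auto

text \<open>Flipping a ray turns the condition \<open>c j > 0\<close> into \<open>c j < 0\<close>
  and costs a factor \<open>-1\<close>. Only earlier indices with the sign of \<open>f i\<close> are
  flipped, which is what lets the sum over \<open>i\<close> telescope.\<close>

definition flip_sign :: "('n::linorder \<Rightarrow> real) \<Rightarrow> 'n \<Rightarrow> 'n \<Rightarrow> real"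
  where "flip_sign f i j = (if j < i \<and> 0 < f i * f j then -1 else 1)"

text \<open>
  The \<open>c j\<close> are the coordinates of a point off the walls, and \<open>Q\<close> is the set of \<open>j\<close> such that \<open>f j\<close> has the
  sign of \<open>F\<close>. Only the \<open>i \<in> Q\<close> contribute, and their sum telescopes, since \<open>[c j > 0] + [c j < 0] = 1\<close>.
  The second end term requires \<open>c < 0\<close> on \<open>Q\<close> and \<open>c > 0\<close> elsewhere, which contradicts the sign of \<open>F\<close>.
\<close>

lemma flip_sign_identity:
  fixes f c :: "'n::{finite,linorder} \<Rightarrow> real"
    and J :: "'n set"
  defines "F \<equiv> \<Sum>j\<in>J. f j * c j"
  assumes c: "\<And>j. c j \<noteq> 0" and F: "F \<noteq> 0"
  shows "of_bool (\<forall>j. 0 \<le> c j) = (\<Sum>i\<in>{i\<in>J. f i \<noteq> 0}. (\<Prod>j\<in>J. flip_sign f i j) *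
    of_bool (\<forall>j. 0 \<le> (if j = i then F / f i else if j \<in> J then flip_sign f i j * c j else c j)))"
proof -
  define Q where "Q = {j\<in>J. 0 < f j * F}"
  define p q :: "'n \<Rightarrow> real" where "p j = of_bool (0 < c j)" and "q j = - of_bool (c j < 0)" for j
  \<comment> \<open>The condition on the coordinates outside \<open>Q\<close> is the same in all
    summands with \<open>i \<in> Q\<close> and factors out.\<close>
  define R :: real where "R = of_bool (\<forall>j. j \<notin> Q \<longrightarrow> 0 < c j)"
  let ?D = "\<lambda>i j. if j = i then F / f i else if j \<in> J then flip_sign f i j * c j else c j"
  have fQ: "0 < f i * f j \<longleftrightarrow> j \<in> Q" if "i \<in> Q" "j \<in> J" for i j
    using that by (auto simp: Q_def zero_less_mult_iff)
  have summand: "(\<Prod>j\<in>J. flip_sign f i j) * of_bool (\<forall>j. 0 \<le> ?D i j) =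
      R * ((\<Prod>j\<in>{j\<in>Q. j < i}. q j) * (p i - q i) * (\<Prod>j\<in>{j\<in>Q. i < j}. p j))" if i: "i \<in> Q" for i
  proof -
    have iJ: "i \<in> J" and Fi: "0 < F / f i"
      using i by (auto simp: Q_def zero_less_mult_iff zero_less_divide_iff)
    have "(\<Prod>j\<in>J. flip_sign f i j) = (\<Prod>j\<in>{j\<in>Q. j < i}. - 1)"
      by (rule prod.mono_neutral_cong_right) (use i fQ in \<open>auto simp: flip_sign_def Q_def\<close>)
    moreover have "(\<forall>j. 0 \<le> ?D i j) \<longleftrightarrow> (\<forall>j. j \<notin> Q \<longrightarrow> 0 < c j) \<and>
        (\<forall>j\<in>{j\<in>Q. j < i}. c j < 0) \<and> (\<forall>j\<in>{j\<in>Q. i < j}. 0 < c j)"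
    proof -
      \<comment> \<open>No \<open>c j\<close> vanishes, so weak inequalities may be exchanged for
        strict ones.\<close>
      have "0 \<le> ?D i j \<longleftrightarrow> (if j = i then True else if j \<in> Q \<and> j < i then c j < 0 else 0 < c j)" for j
        using Fi iJ fQ[OF i, of j] c[of j] i by (auto simp: flip_sign_def Q_def)
      then show ?thesis using i by (auto simp: not_less_iff_gr_or_eq split: if_splits)
    qed
    moreover have "(\<Prod>j\<in>{j\<in>Q. j < i}. q j) = (\<Prod>j\<in>{j\<in>Q. j < i}. - 1) * of_bool (\<forall>j\<in>{j\<in>Q. j < i}. c j < 0)"
      unfolding q_def by (subst prod_of_bool[symmetric], simp, subst prod.distrib[symmetric]) simp
    moreover have "(\<Prod>j\<in>{j\<in>Q. i < j}. p j) = of_bool (\<forall>j\<in>{j\<in>Q. i < j}. 0 < c j)"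
      unfolding p_def by (rule prod_of_bool) simp
    moreover have "p i - q i = 1"
      using c[of i] by (auto simp: p_def q_def)
    ultimately show ?thesis by (simp add: R_def of_bool_conj)
  qed
  have "(\<Sum>i\<in>{i\<in>J. f i \<noteq> 0}. (\<Prod>j\<in>J. flip_sign f i j) * of_bool (\<forall>j. 0 \<le> ?D i j)) =
      (\<Sum>i\<in>Q. (\<Prod>j\<in>J. flip_sign f i j) * of_bool (\<forall>j. 0 \<le> ?D i j))"
  proof (rule sum.mono_neutral_right)
    show "\<forall>i\<in>{i\<in>J. f i \<noteq> 0} - Q. (\<Prod>j\<in>J. flip_sign f i j) * of_bool (\<forall>j. 0 \<le> ?D i j) = 0"
    proof
      fix i assume "i \<in> {i\<in>J. f i \<noteq> 0} - Q"
      then have "F / f i < 0"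
        using F by (auto simp: Q_def divide_less_0_iff zero_less_mult_iff not_less le_less)
      then have "\<not> (\<forall>j. 0 \<le> ?D i j)" by (auto intro!: exI[of _ i])
      then show "(\<Prod>j\<in>J. flip_sign f i j) * of_bool (\<forall>j. 0 \<le> ?D i j) = 0" by simp
    qed
  qed (auto simp: Q_def)
  also have "\<dots> = R * (\<Sum>i\<in>Q. (\<Prod>j\<in>{j\<in>Q. j < i}. q j) * (p i - q i) * (\<Prod>j\<in>{j\<in>Q. i < j}. p j))"
    unfolding sum_distrib_left by (rule sum.cong) (simp_all only: summand)
  also have "\<dots> = R * (\<Prod>j\<in>Q. p j) - R * (\<Prod>j\<in>Q. q j)"
    by (subst prod_diff_telescope) (auto simp: right_diff_distrib)
  also have "R * (\<Prod>j\<in>Q. q j) = 0"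
  proof (rule ccontr)
    assume "R * (\<Prod>j\<in>Q. q j) \<noteq> 0"
    then have R: "\<And>j. j \<notin> Q \<Longrightarrow> 0 < c j" and "\<And>j. j \<in> Q \<Longrightarrow> q j \<noteq> 0"
      by (auto simp: R_def split: if_splits)
    then have Q: "\<And>j. j \<in> Q \<Longrightarrow> c j < 0"
      by (fastforce simp: q_def)
    \<comment> \<open>Summed over \<open>J\<close>, these terms give \<open>F * F\<close>, which is
      positive because \<open>F \<noteq> 0\<close>.\<close>
    have "f j * c j * F \<le> 0" if "j \<in> J" for j
    proof (cases "j \<in> Q")
      case True
      then have "0 < f j * F" "c j < 0" using Q by (auto simp: Q_def)
      then have "f j * F * c j < 0" by (rule mult_pos_neg)
      then show ?thesis by (simp add: mult_ac)
    next
      case False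
      then have "f j * F \<le> 0" "0 < c j" using R that by (auto simp: Q_def)
      then have "f j * F * c j \<le> 0" by (simp add: mult_nonpos_nonneg)
      then show ?thesis by (simp add: mult_ac)
    qed
    then have "(\<Sum>j\<in>J. f j * c j * F) \<le> 0" by (rule sum_nonpos)
    then have "F * F \<le> 0" by (simp add: F_def sum_distrib_right)
    then show False using F by (auto simp: mult_le_0_iff)
  qed
  also have "R * (\<Prod>j\<in>Q. p j) - 0 = of_bool (\<forall>j. 0 \<le> c j)"
  proof -
    have "(\<forall>j. 0 \<le> c j) \<longleftrightarrow> (\<forall>j. j \<notin> Q \<longrightarrow> 0 < c j) \<and> (\<forall>j\<in>Q. 0 < c j)"
      using c by (metis less_le)
    then show ?thesis
      unfolding p_def R_def by (simp add: prod_of_bool of_bool_conj)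
  qed
  finally show ?thesis by simp
qed

text \<open>
  The rays other than \<open>v i\<close> are moved along \<open>v i\<close> into the hyperplane on which the functional with
  values \<open>f\<close> vanishes.
\<close>

definition slide :: "('n \<Rightarrow> real) \<Rightarrow> 'n set \<Rightarrow> 'n::linorder \<Rightarrow> ('n \<Rightarrow> 'a::real_vector) \<Rightarrow> 'n \<Rightarrow> 'a"
  where "slide f J i v j =
    (if j \<in> J \<and> j \<noteq> i then flip_sign f i j *\<^sub>R (v j - (f j / f i) *\<^sub>R v i) else v j)"

text \<open>The dual basis of the slid family. The functional with values \<open>f\<close> on
  \<open>v\<close>, divided by \<open>f i\<close>, kills all slid rays and is \<open>1\<close> on
  \<open>v i\<close>; a flipped ray needs the same sign in its dual vector.\<close>

definition slide_dual :: "('n \<Rightarrow> real) \<Rightarrow> 'n set \<Rightarrow> 'n::linorder \<Rightarrow> ('n \<Rightarrow> 'a::real_vector) \<Rightarrow> 'n \<Rightarrow> 'a"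
  where "slide_dual f J i d j =
    (if j = i then (1 / f i) *\<^sub>R (\<Sum>l\<in>J. f l *\<^sub>R d l) else if j \<in> J then flip_sign f i j *\<^sub>R d j else d j)"

lemma flip_sign_square [simp]: "flip_sign f i j * flip_sign f i j = 1"
  by (simp add: flip_sign_def)

lemma biorthogonal_slide:
  fixes d v :: "'n::{finite,linorder} \<Rightarrow> real^'n::_"
  assumes "biorthogonal d v" "i \<in> J" "f i \<noteq> 0"
  shows "biorthogonal (slide_dual f J i d) (slide f J i v)"
proof -
  have dv: "d l \<bullet> v j = (if l = j then 1 else 0)" for l j
    using assms(1) by (simp add: biorthogonal_def)
  have s: "(\<Sum>l\<in>J. f l * (if l = j then 1 else 0)) = (if j \<in> J then f j else 0)" for j
    using sum.delta[of J j f] by (simp add: if_distrib cong: if_cong)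
  show ?thesis
    unfolding biorthogonal_def
  proof (intro allI)
    fix l j
    show "slide_dual f J i d l \<bullet> slide f J i v j = (if l = j then 1 else 0)"
      using assms(2,3)
      by (auto simp: slide_dual_def slide_def inner_sum_left inner_diff_right dv s
          mult.assoc[symmetric] right_diff_distrib)
  qed
qed

text \<open>By \<open>flip_sign_identity\<close> the two sides agree off the hyperplanes orthogonal
  to the \<open>d j\<close> and to \<open>?a\<close>. Their difference is thus supported on finitely
  many hyperplanes.\<close>

lemma equiv_mod_lower_dim_slide:
  fixes d v :: "'n::{finite,linorder} \<Rightarrow> real^'n::_"
  assumes "biorthogonal d v" "l \<in> J" "f l \<noteq> 0"
  shows "equiv_mod_lower_dim (indicat_real (gen_cone v))
    (\<lambda>x. \<Sum>i\<in>{i\<in>J. f i \<noteq> 0}. (\<Prod>j\<in>J. flip_sign f i j) * indicat_real (gen_cone (slide f J i v)) x)"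
  unfolding equiv_mod_lower_dim_iff
proof (rule cone_comb_lower_dim)
  let ?a = "\<Sum>j\<in>J. f j *\<^sub>R d j"
  let ?I = "{i\<in>J. f i \<noteq> 0}"
  have slide: "biorthogonal (slide_dual f J i d) (slide f J i v)" if "i \<in> ?I" for i
    using biorthogonal_slide[OF assms(1)] that by auto
  show "finite (insert ?a (range d))" by simp
  \<comment> \<open>The nonzero value \<open>f l\<close> shows \<open>?a \<noteq> 0\<close>, so that
    \<open>?a\<close> does define a hyperplane.\<close>
  have "?a \<bullet> v l = f l"
  proof -
    have "?a \<bullet> v l = (\<Sum>j\<in>J. if j = l then f j else 0)"
      unfolding inner_sum_left using assms(1) by (intro sum.cong) (auto simp: biorthogonal_def)
    then show ?thesis using assms(2) by simp
  qed
  then have "?a \<noteq> 0" using assms(3) by auto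
  moreover have "d j \<noteq> 0" for j
    using assms(1) unfolding biorthogonal_def by (metis inner_zero_left zero_neq_one)
  ultimately show "0 \<notin> insert ?a (range d)" by (metis insertE rangeE)
  show "cone_comb polyhedral_cone (\<lambda>x. indicat_real (gen_cone v) x -
      (\<Sum>i\<in>?I. (\<Prod>j\<in>J. flip_sign f i j) * indicat_real (gen_cone (slide f J i v)) x))"
    by (intro cone_comb_diff cone_comb_sum cone_comb_cmult cone_comb_indicator
        polyhedral_cone_gen_cone[OF assms(1)] polyhedral_cone_gen_cone[OF slide])
  fix x
  assume nz: "indicat_real (gen_cone v) x -
      (\<Sum>i\<in>?I. (\<Prod>j\<in>J. flip_sign f i j) * indicat_real (gen_cone (slide f J i v)) x) \<noteq> 0"
  show "\<exists>a\<in>insert ?a (range d). a \<bullet> x = 0"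
  proof (rule ccontr)
    assume "\<not> ?thesis"
    then have "d j \<bullet> x \<noteq> 0" and F: "(\<Sum>j\<in>J. f j * (d j \<bullet> x)) \<noteq> 0" for j
      by (auto simp: inner_sum_left)
    note id = flip_sign_identity[of "\<lambda>j. d j \<bullet> x", OF this]
    have "indicat_real (gen_cone v) x = of_bool (\<forall>j. 0 \<le> d j \<bullet> x)"
      by (simp add: gen_cone_biorthogonal[OF assms(1)] indicator_def)
    moreover have "indicat_real (gen_cone (slide f J i v)) x =
        of_bool (\<forall>j. 0 \<le> (if j = i then (\<Sum>j\<in>J. f j * (d j \<bullet> x)) / f i
          else if j \<in> J then flip_sign f i j * (d j \<bullet> x) else d j \<bullet> x))" if "i \<in> ?I" for i
    proof -
      have "slide_dual f J i d j \<bullet> x = (if j = i then (\<Sum>j\<in>J. f j * (d j \<bullet> x)) / f i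
          else if j \<in> J then flip_sign f i j * (d j \<bullet> x) else d j \<bullet> x)" for j
        by (simp add: slide_dual_def inner_sum_left)
      then show ?thesis
        by (simp only: gen_cone_biorthogonal[OF slide[OF that]] indicator_def mem_Collect_eq)
    qed
    ultimately show False using nz id by simp
  qed
qed

section \<open>Tridiagonal Gram matrices\<close>

lemma prod_flip_sign: "(\<Prod>j\<in>A. flip_sign f i j) \<in> {-1, 1}"
  by (induction A rule: infinite_finite_induct) (auto simp: flip_sign_def)

text \<open>Sliding can be undone inside the span, since \<open>v i\<close> is kept and the flip
  signs are their own inverses. The case of all indices below some \<open>k\<close> preserves
  orthogonality to later vectors; the case of all but the last gives property (c).\<close>

lemma span_slide:
  assumes "i \<in> J" "f i \<noteq> 0" "J \<subseteq> K"
  shows "span (slide f J i v ` K) = span (v ` K)"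
proof (subst span_eq, intro conjI)
  show "slide f J i v ` K \<subseteq> span (v ` K)"
    using assms by (auto simp: slide_def intro!: span_scale span_diff intro: span_base)
  have "slide f J i v i \<in> span (slide f J i v ` K)" and
    sl: "slide f J i v j \<in> span (slide f J i v ` K)" if "j \<in> K" for j
    using assms that by (auto intro!: span_base)
  then have vi: "v i \<in> span (slide f J i v ` K)"
    using assms by (auto simp: slide_def)
  have "v j \<in> span (slide f J i v ` K)" if "j \<in> K" for j
  proof (cases "j \<in> J \<and> j \<noteq> i")
    case True
    then have "v j = flip_sign f i j *\<^sub>R slide f J i v j + (f j / f i) *\<^sub>R v i"
      by (simp add: slide_def)
    then show ?thesis
      using sl[OF that] vi by (metis span_add span_scale)
  next
    case False
    then have "slide f J i v j = v j" by (auto simp: slide_def)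
    then show ?thesis using sl[OF that] by simp
  qed
  then show "v ` K \<subseteq> span (slide f J i v ` K)" by auto
qed

lemma gen_cone_compose:
  fixes v :: "'n::finite \<Rightarrow> real^'n"
  assumes "biorthogonal d v" "bij p"
  shows "gen_cone (v \<circ> p) = gen_cone v"
  unfolding gen_cone_biorthogonal[OF assms(1)]
    gen_cone_biorthogonal[OF biorthogonal_compose[OF assms(1) bij_is_inj[OF assms(2)]]]
  using assms(2) by (simp add: bij_def) (metis surj_f_inv_f)

text \<open>
  Non-neighbours \<open>i < j\<close> are orthogonal, provided that \<open>j\<close> is not one of the first \<open>r\<close> indices; thus
  \<open>r = 0\<close> means that the Gram matrix is tridiagonal.
\<close>

definition path_orthogonal :: "nat \<Rightarrow> ('n::{finite,linorder} \<Rightarrow> 'a::real_inner) \<Rightarrow> bool"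
  where "path_orthogonal r v \<longleftrightarrow> (\<forall>i l j. i < l \<and> l < j \<and> r \<le> card {..<j} \<longrightarrow> v i \<bullet> v j = 0)"

section \<open>Positions of indices and signed sums of cones\<close>

lemma card_lessThan_le_iff:
  fixes i j :: "'n::{finite,linorder}"
  shows "card {..<i} \<le> card {..<j} \<longleftrightarrow> i \<le> j"
proof
  assume "card {..<i} \<le> card {..<j}"
  then show "i \<le> j"
    using psubset_card_mono[of "{..<i}" "{..<j}"] by (force simp: not_le[symmetric])
qed (auto intro!: card_mono)

text \<open>\<open>card {..<k}\<close> is the position of \<open>k\<close> counted from
  \<open>0\<close>. It is injective with values below \<open>n\<close>, hence takes every such
  value.\<close>

lemma ex_card_lessThan:
  assumes "r < CARD('n::{finite,linorder})"
  obtains k :: "'n::{finite,linorder}" where "card {..<k} = r"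
proof -
  have "inj (\<lambda>k::'n. card {..<k})"
    by (rule injI) (metis card_lessThan_le_iff order.antisym order.refl)
  then have "card (range (\<lambda>k::'n. card {..<k})) = CARD('n)"
    by (rule card_image)
  moreover have "card {..<k} < CARD('n)" for k :: 'n
    by (rule psubset_card_mono) auto
  then have "range (\<lambda>k::'n. card {..<k}) \<subseteq> {..<CARD('n)}" by auto
  ultimately have "range (\<lambda>k::'n. card {..<k}) = {..<CARD('n)}"
    by (intro card_subset_eq) auto
  then show ?thesis using assms that by (metis imageE lessThan_iff)
qed

text \<open>A list permits repeated cones and makes concatenation add the bounds on the number of
  terms.\<close>

definition signed_sum ::
    "(('n \<Rightarrow> real^'n) \<Rightarrow> bool) \<Rightarrow> nat \<Rightarrow> (real^'n::finite \<Rightarrow> real) \<Rightarrow> bool"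
  where "signed_sum P n g \<longleftrightarrow> (\<exists>xs. length xs \<le> n \<and> (\<forall>(s, u)\<in>set xs. s \<in> {-1, 1} \<and> P u) \<and>
    equiv_mod_lower_dim g (\<lambda>x. \<Sum>(s, u)\<leftarrow>xs. s * indicat_real (gen_cone u) x))"

lemma equiv_mod_lower_dim_refl: "equiv_mod_lower_dim f f"
  unfolding equiv_mod_lower_dim_iff using cone_comb_zero by simp

lemma equiv_mod_lower_dim_trans:
  "equiv_mod_lower_dim f g \<Longrightarrow> equiv_mod_lower_dim g h \<Longrightarrow> equiv_mod_lower_dim f h"
  unfolding equiv_mod_lower_dim_iff using cone_comb_add by fastforce

lemma equiv_mod_lower_dim_add:
  "equiv_mod_lower_dim f g \<Longrightarrow> equiv_mod_lower_dim f' g' \<Longrightarrow>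
    equiv_mod_lower_dim (\<lambda>x. f x + f' x) (\<lambda>x. g x + g' x)"
  unfolding equiv_mod_lower_dim_iff using cone_comb_add by (fastforce simp: add_diff_add)

lemma equiv_mod_lower_dim_cmult:
  "equiv_mod_lower_dim f g \<Longrightarrow> equiv_mod_lower_dim (\<lambda>x. a * f x) (\<lambda>x. a * g x)"
  unfolding equiv_mod_lower_dim_iff using cone_comb_cmult by (fastforce simp: right_diff_distrib)

lemma signed_sum_gen_cone: "P u \<Longrightarrow> signed_sum P (Suc 0) (indicat_real (gen_cone u))"
  unfolding signed_sum_def by (rule exI[of _ "[(1, u)]"]) (simp add: equiv_mod_lower_dim_refl)

lemma signed_sum_mono: "signed_sum P m g \<Longrightarrow> m \<le> n \<Longrightarrow> signed_sum P n g"
  unfolding signed_sum_def using le_trans by blast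

lemma signed_sum_equiv:
  "equiv_mod_lower_dim f g \<Longrightarrow> signed_sum P n g \<Longrightarrow> signed_sum P n f"
  unfolding signed_sum_def using equiv_mod_lower_dim_trans by blast

lemma signed_sum_add_sign:
  assumes "signed_sum P m f" "s \<in> {-1, 1}" "signed_sum P n g"
  shows "signed_sum P (n + m) (\<lambda>x. s * g x + f x)"
proof -
  obtain xs where xs: "length xs \<le> m" "\<forall>(s, u)\<in>set xs. s \<in> {-1, 1} \<and> P u"
    "equiv_mod_lower_dim f (\<lambda>x. \<Sum>(s, u)\<leftarrow>xs. s * indicat_real (gen_cone u) x)"
    using assms(1) unfolding signed_sum_def by blast
  obtain ys where ys: "length ys \<le> n" "\<forall>(s, u)\<in>set ys. s \<in> {-1, 1} \<and> P u"
    "equiv_mod_lower_dim g (\<lambda>x. \<Sum>(s, u)\<leftarrow>ys. s * indicat_real (gen_cone u) x)"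
    using assms(3) unfolding signed_sum_def by blast
  let ?zs = "map (\<lambda>(t, u). (s * t, u)) ys @ xs"
  have "(\<lambda>x. \<Sum>(s, u)\<leftarrow>?zs. s * indicat_real (gen_cone u) x) =
    (\<lambda>x. s * (\<Sum>(s, u)\<leftarrow>ys. s * indicat_real (gen_cone u) x) + (\<Sum>(s, u)\<leftarrow>xs. s * indicat_real (gen_cone u) x))"
    by (simp add: sum_list_const_mult[symmetric] comp_def case_prod_unfold mult.assoc)
  then show ?thesis
    unfolding signed_sum_def using xs ys assms(2)
    by (intro exI[of _ ?zs])
      (auto simp del: map_append sum_list_append
        intro!: equiv_mod_lower_dim_add equiv_mod_lower_dim_cmult split: prod.splits)
qed

lemma signed_sum_sum:
  assumes "finite I" "\<And>i. i \<in> I \<Longrightarrow> s i \<in> {-1, 1} \<and> signed_sum P n (g i)"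
  shows "signed_sum P (card I * n) (\<lambda>x. \<Sum>i\<in>I. s i * g i x)"
  using assms
proof (induction I rule: finite_induct)
  case empty
  show ?case
    unfolding signed_sum_def by (rule exI[of _ "[]"]) (simp add: equiv_mod_lower_dim_refl)
next
  case (insert i I)
  then show ?case using signed_sum_add_sign[of P "card I * n" _ "s i" n "g i"] by simp
qed

text \<open>What every piece of the recursion must satisfy, with the data of properties (b) and (c)
  frozen as \<open>z\<close> and \<open>S\<close>. Lengths are left free; the generators are
  normalized only at the end.\<close>

definition path_basis ::
    "real^'n::_ \<Rightarrow> (real^'n::_) set \<Rightarrow> ('n::{finite,wellorder} \<Rightarrow> real^'n::_) \<Rightarrow> bool"
  where "path_basis z S u \<longleftrightarrow> (\<exists>d. biorthogonal d u) \<and> path_orthogonal 0 u \<and>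
    u last_index = z \<and> span (u ` {..<last_index}) = S"

lemma le_last_index: "(i::'n::{finite,wellorder}) \<le> last_index"
  unfolding last_index_def by simp

text \<open>After sliding, \<open>v i\<close> is the only vector before position \<open>k\<close>
  not orthogonal to \<open>v k\<close>, and the transposition moves it next to \<open>k\<close>.
  Vectors after \<open>k\<close> are orthogonal to all of \<open>v j\<close>, \<open>j < k\<close>,
  because \<open>k\<close> lies between; sliding stays in the span of these, so this orthogonality
  survives.\<close>

lemma path_orthogonal_slide:
  fixes v :: "'n::{finite,linorder} \<Rightarrow> 'a::real_inner"
  assumes orth: "path_orthogonal (Suc (card {..<k})) v"
    and i: "i < k" "v i \<bullet> v k \<noteq> 0"
  shows "path_orthogonal (card {..<k})
    (slide (\<lambda>j. v j \<bullet> v k) {..<k} i v \<circ> Transposition.transpose i (Max {..<k}))"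
  unfolding path_orthogonal_def
proof (intro allI impI, elim conjE)
  fix a l b :: 'n
  assume ab: "a < l" "l < b" and "card {..<k} \<le> card {..<b}"
  then have kb: "k \<le> b" by (simp add: card_lessThan_le_iff)
  define m where "m = Max {..<k}"
  let ?f = "\<lambda>j. v j \<bullet> v k"
  let ?u = "slide ?f {..<k} i v"
  let ?t = "Transposition.transpose i m"
  have ne: "{..<k} \<noteq> {}" using i(1) by blast
  have mk: "m < k" and m_ge: "\<And>j. j < k \<Longrightarrow> j \<le> m"
    using Max_in[OF _ ne] Max_ge[of "{..<k}"] by (simp_all add: m_def)
  have b: "(?u \<circ> ?t) c = v c" if "k \<le> c" for c
    using that i(1) mk by (auto simp: slide_def Transposition.transpose_def)
  have tk: "?t c < k" if "c < k" for c
    using that i(1) mk by (simp add: Transposition.transpose_def)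
  have "(?u \<circ> ?t) a \<bullet> v b = 0"
  proof (cases "b = k")
    case True
    then have "a < k" "a \<noteq> m" using ab m_ge[of l] by auto
    then have "?t a < k" "?t a \<noteq> i"
      using tk by (auto simp: Transposition.transpose_def)
    then show ?thesis
      using True i(2) by (simp add: slide_def inner_diff_left)
  next
    case False
    then have "k < b" using kb by simp
    then have "Suc (card {..<k}) \<le> card {..<b}"
      by (metis Suc_leI not_le card_lessThan_le_iff)
    then have orth': "v c \<bullet> v b = 0" if "c < e" "e < b" for c e
      using orth that unfolding path_orthogonal_def by blast
    show ?thesis
    proof (cases "a < k")
      case True
      then have "?u (?t a) \<in> span (?u ` {..<k})"
        using tk by (auto intro: span_base)
      also have "\<dots> = span (v ` {..<k})"
        using i by (intro span_slide) auto
      also have "\<dots> \<subseteq> {x. v b \<bullet> x = 0}"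
        using orth'[OF _ \<open>k < b\<close>] by (intro span_minimal subspace_hyperplane) (auto simp: inner_commute)
      finally show ?thesis by (simp add: inner_commute)
    next
      case False
      then show ?thesis using b[of a] orth' ab by simp
    qed
  qed
  then show "(?u \<circ> Transposition.transpose i (Max {..<k})) a \<bullet>
      (?u \<circ> Transposition.transpose i (Max {..<k})) b = 0"
    using b[OF kb] by (simp add: m_def)
qed

text \<open>Stage \<open>Suc r\<close> treats the index \<open>k\<close> with \<open>r\<close>
  predecessors. It yields at most \<open>r\<close> pieces, each needing at most
  \<open>fact (r - 1)\<close> cones, or no cut at all if \<open>v k\<close> is already orthogonal to
  its predecessors. At \<open>r = 0\<close> truncated subtraction gives the bound \<open>1\<close>,
  for the cone itself.\<close>

lemma signed_sum_path_basis:
  fixes v :: "'n::{finite,wellorder} \<Rightarrow> real^'n::_"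
  assumes "biorthogonal d v" "path_orthogonal r v" "r \<le> CARD('n)"
  shows "signed_sum (path_basis (v last_index) (span (v ` {..<last_index}))) (fact (r - 1))
    (indicat_real (gen_cone v))"
  using assms
proof (induction r arbitrary: d v)
  case 0
  then show ?case by (auto intro!: signed_sum_gen_cone simp: path_basis_def)
next
  case (Suc r)
  let ?P = "path_basis (v last_index) (span (v ` {..<last_index}))"
  obtain k :: 'n where k: "card {..<k} = r"
    by (rule ex_card_lessThan[of r]) (use Suc.prems(3) in auto)
  show ?case
  proof (cases "\<exists>j<k. v j \<bullet> v k \<noteq> 0")
    case False
    have "path_orthogonal r v"
      unfolding path_orthogonal_def
    proof (intro allI impI, elim conjE)
      fix i l j :: 'n assume ij: "i < l" "l < j" "r \<le> card {..<j}"
      show "v i \<bullet> v j = 0"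
      proof (cases "j = k")
        case True
        then show ?thesis using False ij by auto
      next
        case False
        then have "Suc r \<le> card {..<j}"
          using ij(3) k card_lessThan_le_iff[of j k] card_lessThan_le_iff[of k j] by auto
        then show ?thesis using Suc.prems(2) ij unfolding path_orthogonal_def by blast
      qed
    qed
    then have "signed_sum ?P (fact (r - 1)) (indicat_real (gen_cone v))"
      using Suc by simp
    then show ?thesis
      by (rule signed_sum_mono) (simp add: fact_mono)
  next
    case True
    then obtain l where l: "l < k" "v l \<bullet> v k \<noteq> 0" by blast
    define f where "f j = v j \<bullet> v k" for j
    define t where "t i = Transposition.transpose i (Max {..<k})" for i
    let ?I = "{i\<in>{..<k}. f i \<noteq> 0}"
    let ?u = "\<lambda>i. slide f {..<k} i v"
    have piece: "signed_sum ?P (fact (r - 1)) (indicat_real (gen_cone (?u i)))" if i: "i \<in> ?I" for i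
    proof -
      have bij: "bij (t i)" by (simp add: t_def)
      have bio: "biorthogonal (slide_dual f {..<k} i d) (?u i)"
        using i by (intro biorthogonal_slide Suc.prems) auto
      have mk: "Max {..<k} < k" using l Max_in[of "{..<k}"] by (metis empty_iff finite lessThan_iff)
      \<comment> \<open>Both transposed indices lie below \<open>k\<close>, hence below the last
        one; the last generator and the span of the others are therefore unaffected.\<close>
      have kl: "k \<le> last_index" by (rule le_last_index)
      have "t i ` {..<last_index} = {..<last_index}"
        unfolding t_def using i mk kl by (intro transpose_image_eq) auto
      then have "(?u i \<circ> t i) ` {..<last_index} = ?u i ` {..<last_index}"
        by (simp only: image_comp[symmetric])
      then have span: "span ((?u i \<circ> t i) ` {..<last_index}) = span (v ` {..<last_index})"
        using i kl by (simp only:) (intro span_slide, auto)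
      have last: "(?u i \<circ> t i) last_index = v last_index"
        using i mk kl by (auto simp: t_def Transposition.transpose_def slide_def)
      have "path_orthogonal r (?u i \<circ> t i)"
        using path_orthogonal_slide[of k v i] Suc.prems(2) i k unfolding f_def t_def by auto
      then have "signed_sum ?P (fact (r - 1)) (indicat_real (gen_cone (?u i \<circ> t i)))"
        by (rule Suc.IH[OF biorthogonal_compose[OF bio bij_is_inj[OF bij]] _ Suc_leD[OF Suc.prems(3)],
              unfolded span last])
      then show ?thesis
        by (simp add: gen_cone_compose[OF bio bij])
    qed
    have "(\<Prod>j<k. flip_sign f i j) \<in> {-1, 1}" for i
      by (rule prod_flip_sign)
    then have sum: "signed_sum ?P (card ?I * fact (r - 1))
        (\<lambda>x. \<Sum>i\<in>?I. (\<Prod>j<k. flip_sign f i j) * indicat_real (gen_cone (?u i)) x)"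
      using piece by (intro signed_sum_sum) auto
    have "card ?I * fact (r - 1) \<le> (r * fact (r - 1) :: nat)"
      unfolding k[symmetric] by (intro mult_right_mono card_mono) auto
    \<comment> \<open>Here \<open>r\<close> is positive, since \<open>l\<close> is a predecessor of
      \<open>k\<close>.\<close>
    also have "r * fact (r - 1) = (fact r :: nat)"
      using k l by (cases r) auto
    finally have "signed_sum ?P (fact r)
        (\<lambda>x. \<Sum>i\<in>?I. (\<Prod>j<k. flip_sign f i j) * indicat_real (gen_cone (?u i)) x)"
      by (rule signed_sum_mono[OF sum])
    moreover have "equiv_mod_lower_dim (indicat_real (gen_cone v))
        (\<lambda>x. \<Sum>i\<in>?I. (\<Prod>j<k. flip_sign f i j) * indicat_real (gen_cone (?u i)) x)"
      by (rule equiv_mod_lower_dim_slide[OF Suc.prems(1), of l]) (use l in \<open>simp_all add: f_def\<close>)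
    ultimately have "signed_sum ?P (fact r) (indicat_real (gen_cone v))"
      by (rule signed_sum_equiv[rotated])
    then show ?thesis by simp
  qed
qed

text \<open>A path has no cycles, so the signs of its edges can be prescribed freely: walk along it
  and change sign exactly after an edge with positive inner product.\<close>

lemma path_orthogonal_signs:
  fixes u :: "'n::{finite,linorder} \<Rightarrow> 'a::real_inner"
  assumes "path_orthogonal 0 u"
  obtains \<epsilon> :: "'n \<Rightarrow> real" where "\<And>i. \<epsilon> i \<in> {-1, 1}"
    "\<And>i j. i \<noteq> j \<Longrightarrow> \<epsilon> i * \<epsilon> j * (u i \<bullet> u j) = - \<bar>u i \<bullet> u j\<bar>"
proof -
  have orth: "u i \<bullet> u j = 0" if "i < l" "l < j" for i l j
    using assms that unfolding path_orthogonal_def by blast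
  \<comment> \<open>By orthogonality only the successor of \<open>i\<close> can be a
    \<open>j > i\<close> with positive inner product.\<close>
  define t :: "'n \<Rightarrow> real" where "t i = (if \<exists>j>i. 0 < u i \<bullet> u j then -1 else 1)" for i
  define \<epsilon> where "\<epsilon> j = (\<Prod>i<j. t i)" for j
  have eps: "\<epsilon> i \<in> {-1, 1}" for i
  proof -
    have "(\<Prod>i\<in>A. t i) \<in> {-1, 1}" for A
      by (induction A rule: infinite_finite_induct) (auto simp: t_def)
    then show ?thesis by (simp add: \<epsilon>_def)
  qed
  have less: "\<epsilon> i * \<epsilon> j * (u i \<bullet> u j) = - \<bar>u i \<bullet> u j\<bar>" if ij: "i < j" for i j
  proof (cases "\<exists>l. i < l \<and> l < j")
    case True
    then show ?thesis using orth by auto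
  next
    case False
    then have "{..<j} = insert i {..<i}"
      using ij by (auto simp: not_less le_less)
    then have "\<epsilon> j = t i * \<epsilon> i" by (simp add: \<epsilon>_def)
    then have "\<epsilon> i * \<epsilon> j = t i" using eps[of i] by auto
    moreover have "t i * (u i \<bullet> u j) = - \<bar>u i \<bullet> u j\<bar>"
    proof (cases "0 < u i \<bullet> u j")
      case True
      then show ?thesis using ij by (auto simp: t_def)
    next
      case nonpos: False
      have "\<not> 0 < u i \<bullet> u j'" if "i < j'" for j'
        using nonpos orth[OF ij, of j'] False that by (cases j' j rule: linorder_cases) auto
      then show ?thesis using nonpos by (auto simp: t_def)
    qed
    ultimately show ?thesis by simp
  qed
  show ?thesis
  proof (rule that[OF eps])
    fix i j :: 'n assume "i \<noteq> j"
    then show "\<epsilon> i * \<epsilon> j * (u i \<bullet> u j) = - \<bar>u i \<bullet> u j\<bar>"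
      using less[of i j] less[of j i] by (cases i j rule: linorder_cases) (auto simp: inner_commute mult_ac)
  qed
qed

section \<open>Positive definiteness, normalization and the complete decomposition\<close>

lemma inner_matrix_vector_mult:
  fixes A :: "real^'n^'n::finite"
  shows "x \<bullet> (A *v x) = (\<Sum>i\<in>UNIV. \<Sum>j\<in>UNIV. A $ i $ j * x $ i * x $ j)"
  by (simp add: inner_vec_def matrix_vector_mult_def sum_distrib_left mult_ac)

text \<open>With the signs of \<open>path_orthogonal_signs\<close>, the associated matrix is the
  Gram matrix of the vectors \<open>\<epsilon> i\<close> times \<open>u i\<close>, which are
  linearly independent.\<close>

lemma good_generators_path_basis:
  fixes w u :: "'n::{finite,wellorder} \<Rightarrow> real^'n::_"
  assumes "path_basis (w last_index) (span (w ` {..<last_index})) u"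
    and norm: "\<And>i. norm (u i) = 1"
  shows "good_generators w u"
proof -
  obtain d where d: "biorthogonal d u"
    using assms(1) by (auto simp: path_basis_def)
  have path: "path_orthogonal 0 u"
    using assms(1) by (simp add: path_basis_def)
  then obtain \<epsilon> :: "'n \<Rightarrow> real" where eps: "\<And>i. \<epsilon> i \<in> {-1, 1}"
    "\<And>i j. i \<noteq> j \<Longrightarrow> \<epsilon> i * \<epsilon> j * (u i \<bullet> u j) = - \<bar>u i \<bullet> u j\<bar>"
    using path_orthogonal_signs by blast
  have uu: "u i \<bullet> u i = 1" for i
    using norm[of i] by (simp add: norm_eq_1)
  have ee: "\<epsilon> i * \<epsilon> i = 1" for i
    using eps(1)[of i] by auto
  have entry: "assoc_matrix u $ i $ j = \<epsilon> i * \<epsilon> j * (u i \<bullet> u j)" for i j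
    using eps(2)[of i j] ee uu by (auto simp: assoc_matrix_def)
  have quad: "x \<bullet> (assoc_matrix u *v x) = (norm (\<Sum>i\<in>UNIV. (\<epsilon> i * x $ i) *\<^sub>R u i))\<^sup>2" for x
    unfolding inner_matrix_vector_mult power2_norm_eq_inner inner_sum_left inner_sum_right entry
    by (simp add: mult_ac inner_commute)
  have "0 < x \<bullet> (assoc_matrix u *v x)" if nz: "x \<noteq> 0" for x
  proof -
    obtain i where "x $ i \<noteq> 0" using nz by (auto simp: vec_eq_iff)
    \<comment> \<open>The dual vector reads off the nonzero coefficient
      \<open>\<epsilon> i * x $ i\<close>.\<close>
    then have "d i \<bullet> (\<Sum>i\<in>UNIV. (\<epsilon> i * x $ i) *\<^sub>R u i) \<noteq> 0"
      using eps(1)[of i] by (auto simp: biorthogonal_inner_sum[OF d])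
    then have "(\<Sum>i\<in>UNIV. (\<epsilon> i * x $ i) *\<^sub>R u i) \<noteq> 0" by auto
    then show ?thesis by (simp add: quad)
  qed
  moreover have "Finite_Cartesian_Product.transpose (assoc_matrix u) = assoc_matrix u"
    by (simp add: vec_eq_iff Finite_Cartesian_Product.transpose_def assoc_matrix_def inner_commute)
  ultimately have "pos_definite (assoc_matrix u)"
    by (simp add: pos_definite_def)
  then show ?thesis
    using assms path eps(1) quad unfolding good_generators_def path_basis_def path_orthogonal_def
    by blast
qed

text \<open>Positive rescaling changes neither the cone nor spans nor orthogonality, and the last
  vector already has length \<open>1\<close>.\<close>

lemma path_basis_normalize:
  fixes u :: "'n::{finite,wellorder} \<Rightarrow> real^'n::_"
  assumes "path_basis z S u" "norm z = 1"
  obtains u' where "path_basis z S u'" "\<And>i. norm (u' i) = 1" "gen_cone u' = gen_cone u"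
proof -
  obtain d where d: "biorthogonal d u"
    using assms(1) by (auto simp: path_basis_def)
  have nz: "u i \<noteq> 0" for i
    using d unfolding biorthogonal_def by (metis inner_zero_right zero_neq_one)
  define u' where "u' i = inverse (norm (u i)) *\<^sub>R u i" for i
  have bio: "biorthogonal (\<lambda>i. inverse (inverse (norm (u i))) *\<^sub>R d i) u'"
    unfolding u'_def using nz by (intro biorthogonal_scale[OF d]) simp
  have "0 \<le> norm (u i) * (d i \<bullet> x) \<longleftrightarrow> 0 \<le> d i \<bullet> x" for i x
    using nz[of i] by (simp add: zero_le_mult_iff)
  then have "gen_cone u' = gen_cone u"
    unfolding gen_cone_biorthogonal[OF d] gen_cone_biorthogonal[OF bio] by simp
  moreover have "norm (u' i) = 1" for i
    using nz by (simp add: u'_def)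
  moreover have "span (u' ` A) = span (u ` A)" for A
  proof (subst span_eq, intro conjI)
    show "u' ` A \<subseteq> span (u ` A)"
      by (auto simp: u'_def intro!: span_scale intro: span_base)
    have "u i = norm (u i) *\<^sub>R u' i" for i
      using nz by (simp add: u'_def)
    then show "u ` A \<subseteq> span (u' ` A)"
      by (metis image_eqI image_subsetI span_base span_scale)
  qed
  moreover have "path_orthogonal 0 u'"
    using assms(1) by (auto simp: path_basis_def path_orthogonal_def u'_def)
  moreover have "u' last_index = z"
    using assms by (simp add: u'_def path_basis_def)
  ultimately show ?thesis
    using that[of u'] bio assms(1) by (auto simp: path_basis_def)
qed

lemma good_decomposition:
  fixes w :: "'n \<Rightarrow> real^'n::{finite,wellorder}"
  assumes norm: "\<forall>i. norm (w i) = 1" and "lin_indep_family w"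
  obtains N :: nat and v :: "nat \<Rightarrow> 'n \<Rightarrow> real^'n::{finite,wellorder}" and s :: "nat \<Rightarrow> real"
  where "N \<le> fact (CARD('n) - 1)"
    "\<And>m. m \<in> {1..N} \<Longrightarrow> s m \<in> {-1, 1} \<and> (\<exists>d. biorthogonal d (v m)) \<and> good_generators w (v m)"
    "equiv_mod_lower_dim (indicat_real (gen_cone w)) (\<lambda>x. \<Sum>m=1..N. s m * indicat_real (gen_cone (v m)) x)"
proof -
  obtain d where d: "biorthogonal d w"
    using biorthogonal_exists[OF assms(2)] .
  \<comment> \<open>Every index has fewer than \<open>n\<close> predecessors, so at
    \<open>r = n\<close> the orthogonality requirement is vacuous and the recursion can
    start.\<close>
  have "card {..<j} < CARD('n)" for j :: 'n
    by (rule psubset_card_mono) auto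
  then have "path_orthogonal CARD('n) w"
    by (auto simp: path_orthogonal_def not_le[symmetric])
  then obtain xs where xs: "length xs \<le> fact (CARD('n) - 1)"
    "\<forall>(s, u)\<in>set xs. s \<in> {-1, 1} \<and> path_basis (w last_index) (span (w ` {..<last_index})) u"
    "equiv_mod_lower_dim (indicat_real (gen_cone w)) (\<lambda>x. \<Sum>(s, u)\<leftarrow>xs. s * indicat_real (gen_cone u) x)"
    using signed_sum_path_basis[OF d, of "CARD('n)"] unfolding signed_sum_def by auto
  \<comment> \<open>List positions start at \<open>0\<close>, the numbering of the cones at
    \<open>1\<close>.\<close>
  define s u where "s m = fst (xs ! (m - 1))" and "u m = snd (xs ! (m - 1))" for m
  have u: "s m \<in> {-1, 1}" "path_basis (w last_index) (span (w ` {..<last_index})) (u m)"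
    if "m \<in> {1..length xs}" for m
    using xs(2) nth_mem[of "m - 1" xs] that by (fastforce simp: s_def u_def case_prod_unfold)+
  have "\<exists>v. path_basis (w last_index) (span (w ` {..<last_index})) v \<and> (\<forall>i. norm (v i) = 1) \<and>
      gen_cone v = gen_cone (u m)" if "m \<in> {1..length xs}" for m
    using path_basis_normalize[OF u(2)[OF that]] norm by metis
  then obtain v where v: "\<And>m. m \<in> {1..length xs} \<Longrightarrow>
      path_basis (w last_index) (span (w ` {..<last_index})) (v m) \<and> (\<forall>i. norm (v m i) = 1) \<and>
      gen_cone (v m) = gen_cone (u m)"
    by metis
  have "(\<Sum>(s, u)\<leftarrow>xs. s * indicat_real (gen_cone u) x) =
      (\<Sum>m=1..length xs. s m * indicat_real (gen_cone (v m)) x)" for x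
  proof -
    have "(\<Sum>(s, u)\<leftarrow>xs. s * indicat_real (gen_cone u) x) =
        (\<Sum>m<length xs. s (Suc m) * indicat_real (gen_cone (u (Suc m))) x)"
      by (simp add: sum_list_sum_nth case_prod_unfold s_def u_def atLeast0LessThan)
    also have "\<dots> = (\<Sum>m=1..length xs. s m * indicat_real (gen_cone (u m)) x)"
      using sum.shift_bounds_Suc_ivl[of "\<lambda>m. s m * indicat_real (gen_cone (u m)) x" 0 "length xs"]
      by (simp add: atLeast0LessThan atLeastLessThanSuc_atLeastAtMost)
    also have "\<dots> = (\<Sum>m=1..length xs. s m * indicat_real (gen_cone (v m)) x)"
      using v by (intro sum.cong) auto
    finally show ?thesis .
  qed
  then have eq: "equiv_mod_lower_dim (indicat_real (gen_cone w))
      (\<lambda>x. \<Sum>m=1..length xs. s m * indicat_real (gen_cone (v m)) x)"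
    using xs(3) by (simp only:)
  have "\<exists>d. biorthogonal d (v m)" "good_generators w (v m)" if "m \<in> {1..length xs}" for m
    using v[OF that] good_generators_path_basis[of w "v m"] by (simp_all add: path_basis_def)
  then show ?thesis
    using xs(1) u(1) eq by (intro that[of "length xs" s v]) auto
qed

section \<open>Solid angles\<close>

lemma integrable_gaussian: "integrable lborel (\<lambda>x::'a::euclidean_space. exp (- (norm x)\<^sup>2))"
  by (rule integrableI_nonneg) (auto simp: nn_integral_gaussian_UNIV)

lemma borel_polyhedral_cone: "polyhedral_cone K \<Longrightarrow> K \<in> sets borel"
  by (simp add: polyhedral_cone_def polyhedron_imp_closed)

lemma solid_angle_polyhedral_cone:
  fixes K :: "'a::euclidean_space set"
  assumes "polyhedral_cone K"
  shows "solid_angle K = pi powr (- (real DIM('a) / 2)) *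
    (\<integral>x. indicat_real K x * exp (- (norm x)\<^sup>2) \<partial>lborel)"
    "integrable lborel (\<lambda>x. indicat_real K x * exp (- (norm x)\<^sup>2))"
  using solid_angle_eq_gaussian_integral[of K] assms borel_polyhedral_cone[OF assms]
    integrable_real_mult_indicator[OF _ integrable_gaussian, of K]
  by (auto simp: polyhedral_cone_def set_lebesgue_integral_def mult.commute)

text \<open>A convex set of smaller affine dimension has empty interior and is therefore negligible;
  being Borel, it is null already before completion.\<close>

lemma lower_dim_cone_null_sets:
  assumes "lower_dim_cone K"
  shows "K \<in> null_sets lborel"
proof -
  have "convex K" using assms by (simp add: polyhedral_cone_def polyhedron_imp_convex)
  moreover have "interior K = {}"
    using assms aff_dim_nonempty_interior[of K] by fastforce
  ultimately have "K \<in> null_sets lebesgue"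
    using negligible_convex_interior negligible_iff_null_sets by blast
  then show ?thesis
    using assms borel_polyhedral_cone[of K] null_sets_completion_iff[of K lborel] by simp
qed

text \<open>In Gaussian form the solid angle is linear in the indicator function, and the
  lower-dimensional cones affect it only on a null set.\<close>

lemma solid_angle_equiv_mod_lower_dim:
  assumes eq: "equiv_mod_lower_dim (indicat_real C) (\<lambda>x. \<Sum>m\<in>I. s m * indicat_real (D m) x)"
    and C: "polyhedral_cone C" and D: "\<And>m. m \<in> I \<Longrightarrow> polyhedral_cone (D m)"
  shows "solid_angle C = (\<Sum>m\<in>I. s m * solid_angle (D m))"
proof -
  let ?g = "\<lambda>x::'a. exp (- (norm x)\<^sup>2)"
  obtain \<K> c where K: "finite \<K>" "\<And>K. K \<in> \<K> \<Longrightarrow> lower_dim_cone K"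
    "\<And>x. indicat_real C x - (\<Sum>m\<in>I. s m * indicat_real (D m) x) = (\<Sum>K\<in>\<K>. c K * indicat_real K x)"
    using eq unfolding equiv_mod_lower_dim_def by blast
  have "\<Union>\<K> \<in> null_sets lborel"
    using K lower_dim_cone_null_sets
    by (metis (no_types, lifting) UN_ball_bex_simps(1) image_ident countable_finite null_sets_UN')
  then have "AE x in lborel. x \<notin> \<Union>\<K>"
    by (rule AE_not_in)
  then have ae: "AE x in lborel. indicat_real C x = (\<Sum>m\<in>I. s m * indicat_real (D m) x)"
  proof (rule AE_mp, intro AE_I2 impI)
    fix x assume "x \<notin> \<Union>\<K>"
    then have "(\<Sum>K\<in>\<K>. c K * indicat_real K x) = 0"
      by (intro sum.neutral) (auto simp: indicator_def)
    then show "indicat_real C x = (\<Sum>m\<in>I. s m * indicat_real (D m) x)"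
      using K(3)[of x] by simp
  qed
  note [measurable] = borel_polyhedral_cone[OF C]
  have [measurable]: "(\<lambda>x. \<Sum>m\<in>I. s m * (indicat_real (D m) x * ?g x)) \<in> borel_measurable lborel"
    using borel_polyhedral_cone[OF D] by (intro borel_measurable_sum) simp
  have "(\<integral>x. indicat_real C x * ?g x \<partial>lborel) = (\<integral>x. (\<Sum>m\<in>I. s m * (indicat_real (D m) x * ?g x)) \<partial>lborel)"
    by (rule integral_cong_AE, measurable) (use ae in \<open>auto simp: sum_distrib_right mult.assoc\<close>)
  also have "\<dots> = (\<Sum>m\<in>I. s m * (\<integral>x. indicat_real (D m) x * ?g x \<partial>lborel))"
    using solid_angle_polyhedral_cone(2)[OF D] by (subst Bochner_Integration.integral_sum) auto
  finally show ?thesis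
    using D by (simp add: solid_angle_polyhedral_cone(1)[OF C] solid_angle_polyhedral_cone(1)[OF D]
        sum_distrib_left mult_ac)
qed

section \<open>The power series\<close>

text \<open>Applied to the map from the orthant onto a cone, and to a scaling that gives Gaussians
  of other widths.\<close>

lemma gaussian_change_of_variables:
  fixes g :: "real^'n::{finite,wellorder} \<Rightarrow> real^'n::_"
  assumes "linear g" "inj g" and S: "S \<in> sets borel" "g ` S \<in> sets borel"
  shows "integrable lborel (\<lambda>y. indicat_real S y * exp (- (norm (g y))\<^sup>2))"
    and "(\<integral>x. indicat_real (g ` S) x * exp (- (norm x)\<^sup>2) \<partial>lborel) =
      \<bar>det (matrix g)\<bar> * (\<integral>y. indicat_real S y * exp (- (norm (g y))\<^sup>2) \<partial>lborel)"
proof -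
  let ?f = "\<lambda>x::real^'n::_. exp (- (norm x)\<^sup>2)"
  let ?D = "\<bar>det (matrix g)\<bar>"
  have D: "?D \<noteq> 0" using assms det_nz_iff_inj[of g] by simp
  have g[measurable]: "g \<in> borel_measurable borel"
    using assms(1) by (intro borel_measurable_continuous_onI linear_continuous_on) (simp add: linear_linear)
  note [measurable] = S
  \<comment> \<open>For Borel data the gauge integral and the integral over \<open>lborel\<close>
    agree; this translates both ways.\<close>
  have conv: "h absolutely_integrable_on T \<longleftrightarrow> integrable lborel (\<lambda>x. indicat_real T x * h x)"
    "h absolutely_integrable_on T \<Longrightarrow> integral T h = (\<integral>x. indicat_real T x * h x \<partial>lborel)"
    if [measurable]: "h \<in> borel_measurable borel" "T \<in> sets borel" for h :: "real^'n::_ \<Rightarrow> real" and T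
  proof -
    have m: "(\<lambda>x. indicat_real T x * h x) \<in> borel_measurable lborel" by measurable
    show "h absolutely_integrable_on T \<longleftrightarrow> integrable lborel (\<lambda>x. indicat_real T x * h x)"
      using integrable_completion[OF m] by (simp add: set_integrable_def)
    show "integral T h = (\<integral>x. indicat_real T x * h x \<partial>lborel)" if "h absolutely_integrable_on T"
      using set_lebesgue_integral_eq_integral(2)[OF that] integral_completion[OF m]
      by (simp add: set_lebesgue_integral_def)
  qed
  have "integrable lborel (\<lambda>x. indicat_real (g ` S) x * ?f x)"
    using integrable_real_mult_indicator[OF _ integrable_gaussian, of "g ` S"] S by (simp add: mult.commute)
  then have fS: "?f absolutely_integrable_on (g ` S)"
    by (subst conv) (use S in auto)
  \<comment> \<open>The change of variables rule concerns vector-valued integrands, so real values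
    pass through \<open>real^1\<close>.\<close>
  then have "(\<lambda>x. vec (?f x) :: real^1) absolutely_integrable_on (g ` S) \<and>
      integral (g ` S) (\<lambda>x. vec (?f x) :: real^1) = vec (integral (g ` S) ?f)"
    by (simp add: absolutely_integrable_on_1_iff integral_on_1_eq)
  then have "(\<lambda>x. ?D *\<^sub>R (vec (?f (g x)) :: real^1)) absolutely_integrable_on S \<and>
      integral S (\<lambda>x. ?D *\<^sub>R (vec (?f (g x)) :: real^1)) = vec (integral (g ` S) ?f)"
    by (subst has_absolute_integral_change_of_variables_linear[OF assms(1)])
  then have gS: "(\<lambda>x. ?D * ?f (g x)) absolutely_integrable_on S"
    and eq: "integral S (\<lambda>x. ?D * ?f (g x)) = integral (g ` S) ?f"
    by (simp_all add: absolutely_integrable_on_1_iff integral_on_1_eq vec_eq_iff)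
  have "integrable lborel (\<lambda>x. indicat_real S x * (?D * ?f (g x)))"
    using gS by (subst (asm) conv) auto
  then have "integrable lborel (\<lambda>x. inverse ?D * (indicat_real S x * (?D * ?f (g x))))"
    by (rule integrable_mult_right)
  moreover have "(\<lambda>x. inverse ?D * (indicat_real S x * (?D * ?f (g x)))) =
      (\<lambda>y. indicat_real S y * ?f (g y))"
    using D by (simp add: fun_eq_iff)
  ultimately show "integrable lborel (\<lambda>y. indicat_real S y * ?f (g y))"
    by (simp only:)
  have "(\<integral>x. indicat_real (g ` S) x * ?f x \<partial>lborel) = integral (g ` S) ?f"
    by (rule conv(2)[symmetric]) (use S fS in auto)
  also have "\<dots> = (\<integral>x. indicat_real S x * (?D * ?f (g x)) \<partial>lborel)"
    unfolding eq[symmetric] by (rule conv(2)) (use S gS in auto)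
  also have "\<dots> = ?D * (\<integral>x. indicat_real S x * ?f (g x) \<partial>lborel)"
    by (subst integral_mult_right_zero[symmetric]) (simp only: mult.left_commute)
  finally show "(\<integral>x. indicat_real (g ` S) x * ?f x \<partial>lborel) =
      ?D * (\<integral>y. indicat_real S y * ?f (g y) \<partial>lborel)" .
qed

text \<open>Take the minimum of the quadratic form on the compact unit sphere and use homogeneity of
  degree two.\<close>

lemma pos_definite_lower_bound:
  fixes M :: "real^'n^'n::finite"
  assumes "pos_definite M"
  obtains c where "0 < c" "\<And>x. c * (norm x)\<^sup>2 \<le> x \<bullet> (M *v x)"
proof -
  have "continuous_on (sphere 0 1) (\<lambda>x. x \<bullet> (M *v x))"
    by (intro continuous_intros matrix_vector_mult_linear_continuous_on)
  moreover have "sphere (0::real^'n) 1 \<noteq> {}" by simp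
  ultimately obtain z where z: "z \<in> sphere 0 1" "\<And>x. x \<in> sphere 0 1 \<Longrightarrow> z \<bullet> (M *v z) \<le> x \<bullet> (M *v x)"
    using continuous_attains_inf[OF compact_sphere, of 0 1 "\<lambda>x. x \<bullet> (M *v x)"] by blast
  show ?thesis
  proof
    show "0 < z \<bullet> (M *v z)"
      using z(1) assms unfolding pos_definite_def by (metis mem_sphere_0 norm_zero zero_neq_one)
    fix x
    show "z \<bullet> (M *v z) * (norm x)\<^sup>2 \<le> x \<bullet> (M *v x)"
    proof (cases "x = 0")
      case False
      then have "z \<bullet> (M *v z) \<le> (inverse (norm x) *\<^sub>R x) \<bullet> (M *v (inverse (norm x) *\<^sub>R x))"
        by (intro z(2)) simp
      also have "\<dots> = x \<bullet> (M *v x) / (norm x)\<^sup>2"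
        by (simp add: matrix_vector_mult_scaleR power2_eq_square divide_inverse mult_ac)
      finally show ?thesis
        using False by (simp add: pos_le_divide_eq)
    qed simp
  qed
qed

text \<open>The closed form in which even Gaussian moments on the half-line appear.\<close>

lemma Gamma_half_plus_nat:
  "Gamma (1 / 2 + real k) = sqrt pi * (fact (2 * k) / (2 ^ (2 * k) * fact k))"
proof (induction k)
  case 0
  then show ?case by (simp add: Gamma_one_half_real)
next
  case (Suc k)
  have "Gamma (1 / 2 + real (Suc k)) = Gamma ((1 / 2 + real k) + 1)"
    by (simp add: add.assoc add.commute)
  also have "\<dots> = (1 / 2 + real k) * Gamma (1 / 2 + real k)"
    by (rule Gamma_plus1) (auto elim!: nonpos_Ints_cases)
  finally have eq: "Gamma (1 / 2 + real (Suc k)) =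
    (1 / 2 + real k) * (sqrt pi * (fact (2 * k) / (2 ^ (2 * k) * fact k)))"
    unfolding Suc.IH .
  show ?case
    unfolding eq by (simp add: divide_simps) (simp add: algebra_simps)
qed

text \<open>Parity decides which values of Gamma occur: half-integers for even \<open>n\<close>,
  factorials for odd \<open>n\<close>.\<close>

lemma gaussian_moment_Gamma:
  "has_bochner_integral lborel (\<lambda>x::real. indicator {0..} x *\<^sub>R (exp (- x\<^sup>2) * x ^ n))
    (Gamma ((1 + real n) / 2) / 2)"
proof (cases "even n")
  case True
  then obtain k where k: "n = 2 * k" by blast
  have eq: "(1 + real n) / 2 = 1 / 2 + real k" by (simp add: k add_divide_distrib)
  show ?thesis
    unfolding eq Gamma_half_plus_nat using gaussian_moment_even_pos[of k] by (simp add: k mult_ac)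
next
  case False
  then obtain k where k: "n = 2 * k + 1" by (blast elim: oddE)
  have eq: "(1 + real n) / 2 = 1 + real k" by (simp add: k add_divide_distrib)
  show ?thesis
    unfolding eq Gamma_fact using gaussian_moment_odd_pos[of k] by (simp add: k)
qed

section \<open>Gaussian moments over the orthant\<close>

abbreviation orthant :: "(real^'n::finite) set"
  where "orthant \<equiv> {y. \<forall>i. 0 \<le> y $ i}"

lemma nn_integral_lborel_vec_prod:
  fixes h :: "'n::finite \<Rightarrow> real \<Rightarrow> ennreal"
  assumes "\<And>i. h i \<in> borel_measurable borel"
  shows "(\<integral>\<^sup>+y. (\<Prod>i\<in>UNIV. h i (y $ i)) \<partial>lborel) = (\<Prod>i\<in>UNIV. \<integral>\<^sup>+t. h i t \<partial>lborel)"
proof -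
  have inj: "inj (\<lambda>i::'n. axis i (1::real))"
    by (auto simp: inj_def axis_eq_axis)
  have B: "(Basis :: (real^'n) set) = range (\<lambda>i. axis i 1)"
    by (auto simp: Basis_vec_def)
  \<comment> \<open>Recovers the coordinate index from a basis vector, to reindex products over
    \<open>Basis\<close>.\<close>
  let ?ix = "inv (\<lambda>i::'n. axis i (1::real))"
  have ix: "?ix (axis i 1) = i" for i
    using inv_f_f[OF inj, of i] by simp
  have "(\<integral>\<^sup>+y. (\<Prod>i\<in>UNIV. h i (y $ i)) \<partial>lborel) = (\<integral>\<^sup>+y. (\<Prod>b\<in>Basis. h (?ix b) (y \<bullet> b)) \<partial>lborel)"
    unfolding B by (simp add: prod.reindex[OF inj] ix inner_axis)
  also have "\<dots> = (\<Prod>b\<in>(Basis :: (real^'n) set). \<integral>\<^sup>+t. h (?ix b) t \<partial>lborel)"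
    by (rule nn_integral_lborel_prod) (use assms in auto)
  also have "\<dots> = (\<Prod>i\<in>UNIV. \<integral>\<^sup>+t. h i t \<partial>lborel)"
    unfolding B by (simp add: prod.reindex[OF inj] ix)
  finally show ?thesis .
qed

lemma indicator_orthant: "indicat_real orthant y = (\<Prod>i\<in>UNIV. indicat_real {0..} (y $ i))"
proof (cases "y \<in> orthant")
  case False
  then obtain i where "\<not> 0 \<le> y $ i" by auto
  then have "(\<Prod>i\<in>UNIV. indicat_real {0..} (y $ i)) = 0"
    by (intro prod_zero) (auto intro!: exI[of _ i] simp: indicator_def)
  then show ?thesis using False by simp
qed auto

lemma closed_orthant: "closed (orthant :: (real^'n::finite) set)"
  using closed_interval_right_cart[of "0 :: real^'n"]
  by (simp add: closed_Collect_all closed_Collect_le)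

text \<open>The integrand is a product of nonnegative functions of single coordinates, so the
  integral is a product of half-line moments.\<close>

lemma gaussian_orthant_moment:
  fixes s :: "'n::finite \<Rightarrow> nat"
  shows "has_bochner_integral lborel
    (\<lambda>y. indicat_real orthant y * exp (- (norm y)\<^sup>2) * (\<Prod>i\<in>UNIV. (y $ i) ^ s i))
    (\<Prod>i\<in>UNIV. Gamma ((1 + real (s i)) / 2) / 2)"
proof -
  let ?h = "\<lambda>(i::'n) (t::real). indicat_real {0..} t *\<^sub>R (exp (- t\<^sup>2) * t ^ s i)"
  have split: "indicat_real orthant y * exp (- (norm y)\<^sup>2) * (\<Prod>i\<in>UNIV. (y $ i) ^ s i) =
      (\<Prod>i\<in>UNIV. ?h i (y $ i))" for y :: "real^'n"
  proof -
    have "exp (- (norm y)\<^sup>2) = (\<Prod>i\<in>UNIV. exp (- (y $ i)\<^sup>2))"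
      unfolding power2_norm_eq_inner inner_vec_def
      by (simp add: exp_sum[symmetric] sum_negf power2_eq_square)
    then show ?thesis
      by (simp add: indicator_orthant prod.distrib mult.assoc)
  qed
  have nn: "0 \<le> ?h i t" for i t by (simp add: indicator_def)
  have "(\<integral>\<^sup>+y. ennreal (\<Prod>i\<in>UNIV. ?h i (y $ i)) \<partial>(lborel :: (real^'n) measure)) =
      (\<integral>\<^sup>+y. (\<Prod>i\<in>UNIV. ennreal (?h i (y $ i))) \<partial>(lborel :: (real^'n) measure))"
    using nn by (simp only: prod_ennreal)
  also have "\<dots> = (\<Prod>i\<in>UNIV. \<integral>\<^sup>+t. ennreal (?h i t) \<partial>lborel)"
    by (rule nn_integral_lborel_vec_prod[of "\<lambda>i t. ennreal (?h i t)"]) measurable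
  also have "\<dots> = (\<Prod>i\<in>UNIV. ennreal (Gamma ((1 + real (s i)) / 2) / 2))"
  proof (rule prod.cong[OF refl])
    fix i :: 'n
    show "(\<integral>\<^sup>+t. ennreal (?h i t) \<partial>lborel) = ennreal (Gamma ((1 + real (s i)) / 2) / 2)"
      using gaussian_moment_Gamma[of "s i"] nn
      by (subst nn_integral_eq_integral) (simp_all only: has_bochner_integral_iff AE_I2)
  qed
  also have "\<dots> = ennreal (\<Prod>i\<in>UNIV. Gamma ((1 + real (s i)) / 2) / 2)"
    by (rule prod_ennreal) (auto intro!: Gamma_real_nonneg)
  finally show ?thesis
    unfolding split using nn
    by (intro has_bochner_integral_nn_integral) (auto intro!: prod_nonneg Gamma_real_nonneg)
qed

section \<open>Pairs of indices, multi-indices and the exponential series\<close>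

lemma sum_symmetric_pairs:
  fixes b :: "'n::{finite,wellorder} \<Rightarrow> 'n \<Rightarrow> real"
  assumes "\<And>i j. b i j = b j i"
  shows "(\<Sum>i\<in>UNIV. \<Sum>j\<in>UNIV. b i j) = (\<Sum>i\<in>UNIV. b i i) + 2 * (\<Sum>(i, j)\<in>index_pairs. b i j)"
proof -
  let ?D = "range (\<lambda>i::'n. (i, i))"
  let ?L = "(\<lambda>(i, j). (j, i)) ` (index_pairs :: ('n \<times> 'n) set)"
  have U: "UNIV = ?D \<union> (index_pairs \<union> ?L)"
    by (auto simp: index_pairs_def image_iff)
  have "(\<Sum>i\<in>UNIV. \<Sum>j\<in>UNIV. b i j) = (\<Sum>(i, j)\<in>UNIV. b i j)"
    by (simp add: sum.cartesian_product)
  also have "\<dots> = (\<Sum>(i, j)\<in>?D. b i j) + (\<Sum>(i, j)\<in>index_pairs \<union> ?L. b i j)"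
    by (subst U, rule sum.union_disjoint) (auto simp: index_pairs_def)
  also have "(\<Sum>(i, j)\<in>index_pairs \<union> ?L. b i j) = (\<Sum>(i, j)\<in>index_pairs. b i j) + (\<Sum>(i, j)\<in>?L. b i j)"
    by (rule sum.union_disjoint) (auto simp: index_pairs_def)
  also have "(\<Sum>(i, j)\<in>?L. b i j) = (\<Sum>(i, j)\<in>index_pairs. b i j)"
    using assms by (subst sum.reindex) (auto simp: inj_on_def case_prod_unfold intro!: sum.cong)
  also have "(\<Sum>(i, j)\<in>?D. b i j) = (\<Sum>i\<in>UNIV. b i i)"
    by (subst sum.reindex) (auto simp: inj_on_def)
  finally show ?thesis by simp
qed

text \<open>Each pair contributes its exponent to both of its variables; collecting by variable
  produces the sums inside the Gamma factors.\<close>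

lemma prod_pairs_power:
  fixes y :: "'n::{finite,wellorder} \<Rightarrow> real"
  shows "(\<Prod>(i, j)\<in>index_pairs. (y i * y j) ^ a (i, j)) =
    (\<Prod>i\<in>UNIV. y i ^ (\<Sum>m\<in>UNIV - {i}. sym_entry a i m))"
proof -
  let ?L = "(\<lambda>(i, j). (j, i)) ` (index_pairs :: ('n \<times> 'n) set)"
  have "(\<Prod>i\<in>UNIV. y i ^ (\<Sum>m\<in>UNIV - {i}. sym_entry a i m)) =
      (\<Prod>(i, m)\<in>Sigma UNIV (\<lambda>i. UNIV - {i}). y i ^ sym_entry a i m)"
    unfolding power_sum by (rule prod.Sigma) auto
  also have "Sigma UNIV (\<lambda>i. UNIV - {i}) = index_pairs \<union> ?L"
    by (auto simp: index_pairs_def image_iff)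
  also have "(\<Prod>(i, m)\<in>index_pairs \<union> ?L. y i ^ sym_entry a i m) =
      (\<Prod>(i, m)\<in>index_pairs. y i ^ sym_entry a i m) * (\<Prod>(i, m)\<in>?L. y i ^ sym_entry a i m)"
    by (rule prod.union_disjoint) (auto simp: index_pairs_def)
  also have "(\<Prod>(i, m)\<in>?L. y i ^ sym_entry a i m) = (\<Prod>(i, m)\<in>index_pairs. y m ^ sym_entry a m i)"
    by (subst prod.reindex) (auto simp: inj_on_def case_prod_unfold intro!: prod.cong)
  also have "(\<Prod>(i, m)\<in>index_pairs. y i ^ sym_entry a i m) * (\<Prod>(i, m)\<in>index_pairs. y m ^ sym_entry a m i) =
      (\<Prod>(i, j)\<in>index_pairs. (y i * y j) ^ a (i, j))"
    unfolding prod.distrib[symmetric]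
    by (rule prod.cong) (auto simp: index_pairs_def sym_entry_def power_mult_distrib min_def max_def)
  finally show ?thesis ..
qed

lemma countable_multi_indices: "countable multi_indices"
  unfolding multi_indices_def by (intro countable_PiE) auto

text \<open>Multiply out one absolutely convergent exponential series per pair. The form with
  \<open>count_space\<close> prepares for Fubini.\<close>

lemma exp_series_multi_indices:
  fixes x :: "'n::{finite,wellorder} \<times> 'n \<Rightarrow> real"
  shows "integrable (count_space multi_indices) (\<lambda>a. \<Prod>p\<in>index_pairs. x p ^ a p / fact (a p))"
    and "(\<integral>a. (\<Prod>p\<in>index_pairs. x p ^ a p / fact (a p)) \<partial>count_space multi_indices) =
      exp (\<Sum>p\<in>index_pairs. x p)"
proof -
  have summ: "Infinite_Set_Sum.abs_summable_on (\<lambda>n. z ^ n / fact n) UNIV"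
    and exp: "infsetsum (\<lambda>n. z ^ n / fact n) UNIV = exp z" for z :: real
  proof -
    have "summable (\<lambda>n. norm (z ^ n / fact n))"
      using summable_norm_exp[of z] by (simp add: divide_inverse mult.commute)
    then show s: "Infinite_Set_Sum.abs_summable_on (\<lambda>n. z ^ n / fact n) UNIV"
      by (simp add: abs_summable_on_nat_iff')
    show "infsetsum (\<lambda>n. z ^ n / fact n) UNIV = exp z"
      by (subst infsetsum_nat'[OF s]) (simp add: exp_def divide_inverse mult.commute)
  qed
  show "integrable (count_space multi_indices) (\<lambda>a. \<Prod>p\<in>index_pairs. x p ^ a p / fact (a p))"
    using abs_summable_on_prod_PiE[of index_pairs "\<lambda>_. UNIV" "\<lambda>p n. x p ^ n / fact n"] summ
    unfolding multi_indices_def Infinite_Set_Sum.abs_summable_on_def by simp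
  show "(\<integral>a. (\<Prod>p\<in>index_pairs. x p ^ a p / fact (a p)) \<partial>count_space multi_indices) =
      exp (\<Sum>p\<in>index_pairs. x p)"
    using infsetsum_prod_PiE[of index_pairs "\<lambda>_. UNIV" "\<lambda>p n. x p ^ n / fact n"] summ exp
    unfolding multi_indices_def infsetsum_def[of _ "PiE _ _"] by (simp add: exp_sum)
qed

text \<open>The integrand is dominated by \<open>exp (- (c * (norm y)\<^sup>2))\<close>, a standard
  Gaussian scaled by \<open>sqrt c\<close>.\<close>

lemma integrable_exp_pos_definite:
  fixes M :: "real^'n::{finite,wellorder}^'n::_"
  assumes "pos_definite M" and S: "S \<in> sets borel"
  shows "integrable lborel (\<lambda>y. indicat_real S y * exp (- (y \<bullet> (M *v y))))"
proof -
  obtain c where c: "0 < c" "\<And>x. c * (norm x)\<^sup>2 \<le> x \<bullet> (M *v x)"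
    using pos_definite_lower_bound[OF assms(1)] by blast
  let ?g = "\<lambda>y::real^'n::_. sqrt c *\<^sub>R y"
  have "surj ?g"
    using c(1) by (intro surjI[of _ "\<lambda>y. inverse (sqrt c) *\<^sub>R y"]) simp
  then have "integrable lborel (\<lambda>y. indicat_real UNIV y * exp (- (norm (?g y))\<^sup>2))"
    using c(1) by (intro gaussian_change_of_variables(1)) (auto simp: inj_def)
  then have "integrable lborel (\<lambda>y::real^'n::_. exp (- (c * (norm y)\<^sup>2)))"
    using c(1) by (simp add: power_mult_distrib)
  moreover have "(\<lambda>y. y \<bullet> (M *v y)) \<in> borel_measurable borel"
    by (intro borel_measurable_continuous_onI continuous_intros matrix_vector_mult_linear_continuous_on)
  ultimately show ?thesis
    using S c(2) by (elim Bochner_Integration.integrable_bound)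
      (auto simp: indicator_def intro!: AE_I2)
qed

text \<open>The two forms differ only in the absolute values on the coefficients. This is how the
  associated matrix arises as majorant on the orthant.\<close>

lemma quadratic_form_index_pairs:
  fixes y :: "real^'n::{finite,wellorder}" and v :: "'n \<Rightarrow> real^'n::_"
  assumes "\<And>i. norm (v i) = 1"
  shows "(norm (\<Sum>i\<in>UNIV. y $ i *\<^sub>R v i))\<^sup>2 =
      (norm y)\<^sup>2 - (\<Sum>(i, j)\<in>index_pairs. - 2 * (v i \<bullet> v j) * (y $ i * y $ j))"
    and "y \<bullet> (assoc_matrix v *v y) =
      (norm y)\<^sup>2 - (\<Sum>(i, j)\<in>index_pairs. \<bar>- 2 * (v i \<bullet> v j)\<bar> * (y $ i * y $ j))"
proof -
  have vv: "v i \<bullet> v i = 1" for i using assms[of i] by (simp add: norm_eq_1)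
  have ny: "(norm y)\<^sup>2 = (\<Sum>i\<in>UNIV. y $ i * y $ i)"
    unfolding power2_norm_eq_inner inner_vec_def by simp
  have "(norm (\<Sum>i\<in>UNIV. y $ i *\<^sub>R v i))\<^sup>2 = (\<Sum>i\<in>UNIV. \<Sum>j\<in>UNIV. (v i \<bullet> v j) * (y $ i * y $ j))"
    unfolding power2_norm_eq_inner inner_sum_left inner_sum_right inner_scaleR_left inner_scaleR_right
    unfolding sum_distrib_left by (intro sum.cong refl) (simp add: mult_ac inner_commute)
  also have "\<dots> = (norm y)\<^sup>2 + 2 * (\<Sum>(i, j)\<in>index_pairs. (v i \<bullet> v j) * (y $ i * y $ j))"
    by (subst sum_symmetric_pairs[of "\<lambda>i j. (v i \<bullet> v j) * (y $ i * y $ j)"])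
      (simp_all only: vv ny mult_1_left inner_commute mult.commute)
  finally show "(norm (\<Sum>i\<in>UNIV. y $ i *\<^sub>R v i))\<^sup>2 =
      (norm y)\<^sup>2 - (\<Sum>(i, j)\<in>index_pairs. - 2 * (v i \<bullet> v j) * (y $ i * y $ j))"
    using sum_distrib_left[of "- 2" "\<lambda>(i, j). (v i \<bullet> v j) * (y $ i * y $ j)" index_pairs]
    by (simp add: case_prod_unfold mult.assoc)
  have "y \<bullet> (assoc_matrix v *v y) =
      (\<Sum>i\<in>UNIV. \<Sum>j\<in>UNIV. (if i = j then 1 else - \<bar>v i \<bullet> v j\<bar>) * (y $ i * y $ j))"
    unfolding inner_vec_def matrix_vector_mult_def assoc_matrix_def vec_lambda_beta
      inner_real_def sum_distrib_left
    by (intro sum.cong refl) (simp only: mult_ac)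
  also have "\<dots> = (norm y)\<^sup>2 +
      2 * (\<Sum>(i, j)\<in>index_pairs. (if i = j then 1 else - \<bar>v i \<bullet> v j\<bar>) * (y $ i * y $ j))"
    by (subst sum_symmetric_pairs[of "\<lambda>i j. (if i = j then 1 else - \<bar>v i \<bullet> v j\<bar>) * (y $ i * y $ j)"])
      (simp_all only: ny inner_commute mult.commute eq_commute simp_thms if_True mult_1_left)
  also have "2 * (\<Sum>(i, j)\<in>index_pairs. (if i = j then 1 else - \<bar>v i \<bullet> v j\<bar>) * (y $ i * y $ j)) =
      - (\<Sum>(i, j)\<in>index_pairs. \<bar>- 2 * (v i \<bullet> v j)\<bar> * (y $ i * y $ j))"
    unfolding sum_distrib_left sum_negf[symmetric]
  proof (rule sum.cong[OF refl], clarify)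
    fix i j :: 'n assume "(i, j) \<in> index_pairs"
    then have "i \<noteq> j" by (auto simp: index_pairs_def)
    then show "2 * ((if i = j then 1 else - \<bar>v i \<bullet> v j\<bar>) * (y $ i * y $ j)) =
        - (\<bar>- 2 * (v i \<bullet> v j)\<bar> * (y $ i * y $ j))"
      by (simp add: abs_mult)
  qed
  finally show "y \<bullet> (assoc_matrix v *v y) =
      (norm y)\<^sup>2 - (\<Sum>(i, j)\<in>index_pairs. \<bar>- 2 * (v i \<bullet> v j)\<bar> * (y $ i * y $ j))"
    by simp
qed

text \<open>The diagonal part of the quadratic form stays in the Gaussian weight; only the mixed
  part is expanded into its exponential series.\<close>

definition expansion_term ::
    "('n \<Rightarrow> real^'n::{finite,wellorder}) \<Rightarrow> ('n \<times> 'n \<Rightarrow> nat) \<Rightarrow> real^'n::{finite,wellorder} \<Rightarrow> real"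
  where "expansion_term v a y = indicat_real orthant y * exp (- (norm y)\<^sup>2) *
    (\<Prod>(i, j)\<in>index_pairs. (- 2 * (v i \<bullet> v j) * (y $ i * y $ j)) ^ a (i, j) / fact (a (i, j)))"

lemma has_integral_expansion_term:
  fixes v :: "'n \<Rightarrow> real^'n::{finite,wellorder}"
  shows "has_bochner_integral lborel (expansion_term v a) (series_term v a / 2 ^ CARD('n))"
proof -
  let ?s = "\<lambda>i. \<Sum>m\<in>UNIV - {i}. sym_entry a i m"
  let ?c = "\<Prod>(i, j)\<in>index_pairs. (- 2 * (v i \<bullet> v j)) ^ a (i, j) / fact (a (i, j))"
  have expand: "expansion_term v a y = ?c * (indicat_real orthant y * exp (- (norm y)\<^sup>2) * (\<Prod>i\<in>UNIV. (y $ i) ^ ?s i))" for y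
  proof -
    have "(\<Prod>(i, j)\<in>index_pairs. (- 2 * (v i \<bullet> v j) * (y $ i * y $ j)) ^ a (i, j) / fact (a (i, j))) =
        ?c * (\<Prod>(i, j)\<in>index_pairs. (y $ i * y $ j) ^ a (i, j))"
      unfolding prod.distrib[symmetric]
      by (rule prod.cong) (simp_all only: case_prod_unfold power_mult_distrib times_divide_eq_left)
    then show ?thesis
      by (simp only: expansion_term_def prod_pairs_power mult_ac)
  qed
  \<comment> \<open>Each half-line moment carries a factor \<open>1 / 2\<close>, whence
    \<open>2 ^ CARD('n)\<close>.\<close>
  have coeff: "?c * (\<Prod>i\<in>UNIV. Gamma ((1 + real (?s i)) / 2) / 2) = series_term v a / 2 ^ CARD('n)"
  proof -
    have "?c = (- 2) ^ (\<Sum>p\<in>index_pairs. a p) / (\<Prod>p\<in>index_pairs. fact (a p)) *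
        (\<Prod>(i, j)\<in>index_pairs. (v i \<bullet> v j) ^ a (i, j))"
      by (simp only: case_prod_unfold prod_dividef power_mult_distrib prod.distrib power_sum
          prod.collapse times_divide_eq_left)
    then show ?thesis
      by (simp add: series_term_def prod_dividef mult_ac)
  qed
  show ?thesis
    unfolding coeff[symmetric] ext[of "expansion_term v a", OF expand]
    by (intro has_bochner_integral_mult_right gaussian_orthant_moment)
qed

lemma expansion_term_sum:
  fixes v :: "'n \<Rightarrow> real^'n::{finite,wellorder}"
  assumes norm: "\<And>i. norm (v i) = 1"
  shows "(\<integral>a. expansion_term v a y \<partial>count_space multi_indices) =
      indicat_real orthant y * exp (- (norm (\<Sum>i\<in>UNIV. y $ i *\<^sub>R v i))\<^sup>2)"
    and "(\<integral>\<^sup>+a. ennreal (norm (expansion_term v a y)) \<partial>count_space multi_indices) =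
      ennreal (indicat_real orthant y * exp (- (y \<bullet> (assoc_matrix v *v y))))"
proof -
  let ?w = "indicat_real orthant y * exp (- (norm y)\<^sup>2)"
  define x where "x = (\<lambda>(i, j). - 2 * (v i \<bullet> v j) * (y $ i * y $ j))"
  have et: "expansion_term v a y = ?w * (\<Prod>p\<in>index_pairs. x p ^ a p / fact (a p))" for a
    by (simp add: expansion_term_def x_def case_prod_unfold)
  have "(\<integral>a. expansion_term v a y \<partial>count_space multi_indices) = ?w * exp (\<Sum>p\<in>index_pairs. x p)"
    unfolding et by (simp add: exp_series_multi_indices)
  also have "\<dots> = indicat_real orthant y * exp (- (norm (\<Sum>i\<in>UNIV. y $ i *\<^sub>R v i))\<^sup>2)"
    unfolding quadratic_form_index_pairs(1)[OF norm] x_def mult.assoc exp_add[symmetric] by simp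
  finally show "(\<integral>a. expansion_term v a y \<partial>count_space multi_indices) =
      indicat_real orthant y * exp (- (norm (\<Sum>i\<in>UNIV. y $ i *\<^sub>R v i))\<^sup>2)" .
  have "norm (expansion_term v a y) = ?w * (\<Prod>p\<in>index_pairs. \<bar>x p\<bar> ^ a p / fact (a p))" for a
    unfolding et by (simp add: abs_mult abs_prod power_abs)
  then have "(\<integral>\<^sup>+a. ennreal (norm (expansion_term v a y)) \<partial>count_space multi_indices) =
      (\<integral>\<^sup>+a. ennreal (?w * (\<Prod>p\<in>index_pairs. \<bar>x p\<bar> ^ a p / fact (a p))) \<partial>count_space multi_indices)"
    by simp
  also have "\<dots> = ennreal (\<integral>a. ?w * (\<Prod>p\<in>index_pairs. \<bar>x p\<bar> ^ a p / fact (a p)) \<partial>count_space multi_indices)"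
    by (rule nn_integral_eq_integral)
      (auto intro!: integrable_mult_right exp_series_multi_indices(1) AE_I2 mult_nonneg_nonneg prod_nonneg)
  also have "\<dots> = ennreal (?w * exp (\<Sum>p\<in>index_pairs. \<bar>x p\<bar>))"
    by (simp add: exp_series_multi_indices)
  also have "?w * exp (\<Sum>p\<in>index_pairs. \<bar>x p\<bar>) =
      indicat_real orthant y * exp (- (y \<bullet> (assoc_matrix v *v y)))"
  proof (cases "y \<in> orthant")
    case True
    \<comment> \<open>On the orthant the products \<open>y $ i * y $ j\<close> are nonnegative, so
      the absolute value falls on the coefficient alone.\<close>
    then have "(\<Sum>p\<in>index_pairs. \<bar>x p\<bar>) = (\<Sum>(i, j)\<in>index_pairs. \<bar>- 2 * (v i \<bullet> v j)\<bar> * (y $ i * y $ j))"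
      by (intro sum.cong) (auto simp: x_def abs_mult)
    then show ?thesis
      unfolding quadratic_form_index_pairs(2)[OF norm] mult.assoc exp_add[symmetric] by simp
  qed simp
  finally show "(\<integral>\<^sup>+a. ennreal (norm (expansion_term v a y)) \<partial>count_space multi_indices) =
      ennreal (indicat_real orthant y * exp (- (y \<bullet> (assoc_matrix v *v y))))" .
qed

text \<open>Tonelli bounds the double integral of absolute values by that of
  \<open>exp (- (y \<bullet> (assoc_matrix v *v y)))\<close>, which is finite; Fubini then exchanges
  sum and integral.\<close>

lemma series_integral:
  fixes v :: "'n \<Rightarrow> real^'n::{finite,wellorder}"
  assumes norm: "\<And>i. norm (v i) = 1" and pos: "pos_definite (assoc_matrix v)"
  shows "integrable (count_space multi_indices) (series_term v)"
    and "(\<integral>a. series_term v a \<partial>count_space multi_indices) =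
      2 ^ CARD('n) * (\<integral>y. indicat_real orthant y * exp (- (norm (\<Sum>i\<in>UNIV. y $ i *\<^sub>R v i))\<^sup>2) \<partial>lborel)"
proof -
  let ?A = "multi_indices :: ('n \<times> 'n \<Rightarrow> nat) set"
  let ?L = "lborel :: (real^'n::_) measure"
  interpret pair_sigma_finite "count_space ?A" ?L
    by (intro pair_sigma_finite.intro sigma_finite_measure_count_space_countable
        countable_multi_indices sigma_finite_lborel)
  let ?H = "\<lambda>(a, y). expansion_term v a y"
  have expansion_meas: "expansion_term v a \<in> borel_measurable ?L" for a
    using has_integral_expansion_term[of v a] unfolding has_bochner_integral_iff
    by (blast dest: borel_measurable_integrable)
  have meas: "?H \<in> borel_measurable (count_space ?A \<Otimes>\<^sub>M ?L)"
    by (rule measurable_pair_measure_countable1[OF countable_multi_indices])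
      (use expansion_meas in simp)
  have "(\<integral>\<^sup>+p. ennreal (norm (?H p)) \<partial>(count_space ?A \<Otimes>\<^sub>M ?L)) =
      (\<integral>\<^sup>+y. (\<integral>\<^sup>+a. ennreal (norm (expansion_term v a y)) \<partial>count_space ?A) \<partial>?L)"
    using meas by (subst nn_integral_snd[symmetric]) auto
  also have "\<dots> = (\<integral>\<^sup>+y. ennreal (indicat_real orthant y * exp (- (y \<bullet> (assoc_matrix v *v y)))) \<partial>?L)"
    by (simp only: expansion_term_sum(2)[OF norm])
  also have "\<dots> < \<infinity>"
    using integrable_exp_pos_definite[OF pos, of orthant] closed_orthant
    by (subst nn_integral_eq_integral) auto
  finally have int: "integrable (count_space ?A \<Otimes>\<^sub>M ?L) (case_prod (expansion_term v))"
    using meas by (simp add: integrable_iff_bounded)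
  have inner_integral: "(\<integral>y. expansion_term v a y \<partial>?L) = series_term v a / 2 ^ CARD('n)" for a
    using has_integral_expansion_term by (rule has_bochner_integral_integral_eq)
  have "integrable (count_space ?A) (\<lambda>a. series_term v a / 2 ^ CARD('n))"
    using integrable_fst'[OF int] by (simp add: inner_integral)
  then have "integrable (count_space ?A) (\<lambda>a. 2 ^ CARD('n) * (series_term v a / 2 ^ CARD('n)))"
    by (rule integrable_mult_right)
  then show "integrable (count_space ?A) (series_term v)" by simp
  have "(\<integral>a. series_term v a \<partial>count_space ?A) = 2 ^ CARD('n) * (\<integral>a. (\<integral>y. expansion_term v a y \<partial>?L) \<partial>count_space ?A)"
    by (simp add: inner_integral)
  also have "\<dots> = 2 ^ CARD('n) * (\<integral>y. (\<integral>a. expansion_term v a y \<partial>count_space ?A) \<partial>?L)"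
    by (subst Fubini_integral[OF int]) simp
  finally show "(\<integral>a. series_term v a \<partial>count_space ?A) =
      2 ^ CARD('n) * (\<integral>y. indicat_real orthant y * exp (- (norm (\<Sum>i\<in>UNIV. y $ i *\<^sub>R v i))\<^sup>2) \<partial>?L)"
    by (simp only: expansion_term_sum(1)[OF norm])
qed

text \<open>Parametrizing the cone by the orthant gives the Jacobian
  \<open>\<bar>det V\<bar>\<close>, where \<open>V\<close> has columns \<open>v i\<close>. The
  factor \<open>2 ^ CARD('n)\<close> from the moments accounts for the \<open>4\<close> in the power
  of \<open>4 * pi\<close>.\<close>

theorem Ribando_series:
  fixes v :: "'n \<Rightarrow> real^'n::{finite,wellorder}"
  assumes bio: "biorthogonal d v" and norm: "\<And>i. norm (v i) = 1"
    and pos: "pos_definite (assoc_matrix v)"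
  shows "series_converges_to v (solid_angle (gen_cone v))"
proof -
  define g where "g y = (\<Sum>i\<in>UNIV. y $ i *\<^sub>R v i)" for y :: "real^'n::_"
  have lin: "linear g"
    unfolding g_def by (intro linearI) (simp_all add: scaleR_add_left sum.distrib scaleR_sum_right)
  have "y $ i = d i \<bullet> g y" for y i
    unfolding g_def biorthogonal_inner_sum[OF bio] ..
  then have inj: "inj g"
    by (intro injI) (metis vec_eq_iff)
  have img: "gen_cone v = g ` orthant"
  proof (intro equalityI subsetI)
    fix x assume "x \<in> gen_cone v"
    then obtain c where "x = (\<Sum>i\<in>UNIV. c i *\<^sub>R v i)" "\<forall>i. 0 \<le> c i"
      by (auto simp: gen_cone_def)
    then show "x \<in> g ` orthant"
      by (intro image_eqI[of _ _ "\<chi> i. c i"]) (auto simp: g_def)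
  qed (auto simp: gen_cone_def g_def)
  have "closed (gen_cone v)"
    unfolding gen_cone_biorthogonal[OF bio]
    by (intro closed_Collect_all closed_halfspace_component_ge closed_Collect_le continuous_intros)
  then have borel: "gen_cone v \<in> sets borel" "(orthant :: (real^'n::_) set) \<in> sets borel"
    using closed_orthant by (simp_all add: borel_closed)
  have conic: "conic (gen_cone v)"
    unfolding gen_cone_biorthogonal[OF bio] by (simp add: conic_def)
  have "g (axis j 1) = v j" for j
    by (simp add: g_def axis_def if_distrib[of "\<lambda>c. c *\<^sub>R _"] cong: if_cong)
  then have mat: "matrix g = (\<chi> i j. v j $ i)"
    by (simp add: matrix_def)
  let ?I = "\<integral>y. indicat_real orthant y * exp (- (norm (g y))\<^sup>2) \<partial>lborel"
  have "solid_angle (gen_cone v) = pi powr (- (real CARD('n) / 2)) * (\<bar>det (matrix g)\<bar> * ?I)"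
    using solid_angle_eq_gaussian_integral[OF conic borel(1)] borel
      gaussian_change_of_variables(2)[OF lin inj, of orthant]
    by (simp add: img[symmetric] set_lebesgue_integral_def)
  moreover have "series_factor v * (2 ^ CARD('n) * ?I) = pi powr (- (real CARD('n) / 2)) * (\<bar>det (matrix g)\<bar> * ?I)"
  proof -
    have "(4 * pi) powr (real CARD('n) / 2) = 2 ^ CARD('n) * pi powr (real CARD('n) / 2)"
    proof -
      have "(4::real) powr (real CARD('n) / 2) = (2 powr 2) powr (real CARD('n) / 2)" by simp
      also have "\<dots> = 2 ^ CARD('n)"
        unfolding powr_powr by (simp add: powr_realpow)
      finally show ?thesis by (simp add: powr_mult)
    qed
    then show ?thesis by (simp add: series_factor_def mat powr_minus field_simps)
  qed
  moreover have abs: "Infinite_Set_Sum.abs_summable_on (series_term v) multi_indices"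
    using series_integral(1)[OF norm pos] by (simp add: Infinite_Set_Sum.abs_summable_on_def)
  moreover have "(\<Sum>\<^sub>\<infinity>a\<in>multi_indices. series_term v a) = 2 ^ CARD('n) * ?I"
    using series_integral(2)[OF norm pos] infsetsum_infsum[OF abs]
    by (simp add: infsetsum_def g_def)
  ultimately show ?thesis
    using abs_summable_equivalent[of "series_term v" multi_indices]
    by (simp add: series_converges_to_def)
qed

theorem corollary3p4:
  fixes w :: "'n \<Rightarrow> real^'n::{finite,wellorder}"
  assumes "\<forall>i. norm (w i) = 1"
    and "lin_indep_family w"
  shows "\<exists>(N::nat) (C :: nat \<Rightarrow> (real^'n::{finite,wellorder}) set) (s :: nat \<Rightarrow> real).
    N \<le> fact (CARD('n) - 1) \<and>
    (\<forall>m\<in>{1..N}. aff_dim (C m) = int CARD('n) \<and> s m \<in> {-1, 1}) \<and>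
    equiv_mod_lower_dim (indicat_real (gen_cone w)) (\<lambda>x. \<Sum>m=1..N. s m * indicat_real (C m) x) \<and>
    (\<forall>m\<in>{1..N}. \<exists>v. C m = gen_cone v \<and> good_generators w v \<and>
      series_converges_to v (solid_angle (C m))) \<and>
    solid_angle (gen_cone w) = (\<Sum>m=1..N. s m * solid_angle (C m))"
proof -
  obtain N :: nat and v :: "nat \<Rightarrow> 'n \<Rightarrow> real^'n::_" and s :: "nat \<Rightarrow> real" where N: "N \<le> fact (CARD('n) - 1)"
    and v: "\<And>m. m \<in> {1..N} \<Longrightarrow> s m \<in> {-1, 1} \<and> (\<exists>d. biorthogonal d (v m)) \<and> good_generators w (v m)"
    and eq: "equiv_mod_lower_dim (indicat_real (gen_cone w)) (\<lambda>x. \<Sum>m=1..N. s m * indicat_real (gen_cone (v m)) x)"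
    by (rule good_decomposition[OF assms]) blast
  obtain d where "biorthogonal d w"
    using biorthogonal_exists[OF assms(2)] .
  then have angle: "solid_angle (gen_cone w) = (\<Sum>m=1..N. s m * solid_angle (gen_cone (v m)))"
    using v polyhedral_cone_gen_cone by (intro solid_angle_equiv_mod_lower_dim[OF eq]) blast+
  \<comment> \<open>Positive definiteness of the associated matrix is part of
    \<open>good_generators\<close>.\<close>
  have "series_converges_to (v m) (solid_angle (gen_cone (v m)))" if "m \<in> {1..N}" for m
    using v[OF that] Ribando_series unfolding good_generators_def by blast
  then show ?thesis
    using N v eq angle aff_dim_gen_cone
    by (intro exI[of _ N] exI[of _ "\<lambda>m. gen_cone (v m)"] exI[of _ s]) blast
qed

end
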